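(* For each $\varepsilon>0$ there exists $d_0$ such that for each $d\ge d_0$, with high probability $\mathrm{spr}(G_{n,d})<1/4+\varepsilon$.
   Context: $G_{n,d}$ is the uniformly random $d$-regular graph on $\{1,\dots,n\}$ ($n$ even when $d$ is odd); "with high probability" means with probability $1-o(1)$ as $n\to\infty$ (for fixed $d$). A Lipschitz function on a graph $G$ is $f:V(G)\to\mathbb{R}$ with $|f(v)-f(w)|\le1$ for adjacent $v,w$; $\mathrm{Var}(f)$ is the variance of $f(X)$ for $X$ uniform on $V(G)$; for connected $G$, $\mathrm{spr}(G)$ is the supremum of $\mathrm{Var}(f)$ over Lipschitz $f$. *)

theory Defs
  imports "HOL-Analysis.Analysis"
begin

text \<open>Simple graphs on the vertex set {0..<n} (a relabelling of {1..n}), given by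
  their set of edges, each edge a 2-element set of vertices.\<close>

definition regular_graphs :: "nat \<Rightarrow> nat \<Rightarrow> nat set set set" where
  "regular_graphs n d =
     {E. E \<subseteq> {{u, v} | u v. u < n \<and> v < n \<and> u \<noteq> v} \<and>
         (\<forall>v<n. card {e \<in> E. v \<in> e} = d)}"

definition lipschitz :: "nat set set \<Rightarrow> (nat \<Rightarrow> real) \<Rightarrow> bool" where
  "lipschitz E f \<longleftrightarrow> (\<forall>v w. {v, w} \<in> E \<longrightarrow> \<bar>f v - f w\<bar> \<le> 1)"

definition variance_unif :: "nat \<Rightarrow> (nat \<Rightarrow> real) \<Rightarrow> real" where
  "variance_unif n f = (\<Sum>v<n. (f v)^2) / real n - ((\<Sum>v<n. f v) / real n)^2"

text \<open>Spread: supremum of variances of Lipschitz functions, in the extended reals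
  (equals +infinity exactly when the graph is disconnected).\<close>
definition spread :: "nat \<Rightarrow> nat set set \<Rightarrow> ereal" where
  "spread n E = (SUP f \<in> {f. lipschitz E f}. ereal (variance_unif n f))"

definition prob_Gnd :: "nat \<Rightarrow> nat \<Rightarrow> (nat set set \<Rightarrow> bool) \<Rightarrow> real" where
  "prob_Gnd n d P = real (card {E \<in> regular_graphs n d. P E}) / real (card (regular_graphs n d))"

definition whp :: "nat \<Rightarrow> (nat \<Rightarrow> nat set set \<Rightarrow> bool) \<Rightarrow> bool" where
  "whp d P \<longleftrightarrow> (\<forall>\<delta>>0. \<exists>N. \<forall>n\<ge>N. even (n * d) \<longrightarrow> prob_Gnd n d (P n) \<ge> 1 - \<delta>)"

end

theory Submission
  imports Defs
begin

text \<open>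
  Two properties of a \<open>d\<close>-regular graph bound the variance of every Lipschitz function \<open>f\<close>. If any two
  disjoint sets of \<open>\<delta>n\<close> vertices are joined by an edge, then, with \<open>t\<close> the lower \<open>\<delta>\<close>-quantile of \<open>f\<close>, all
  but \<open>2\<delta>n\<close> values of \<open>f\<close> lie in \<open>[t, t + 1]\<close>, which accounts for the \<open>1/4\<close>. If moreover every set of at
  most \<open>\<delta>n\<close> vertices at least doubles when its neighbours are added, the level sets outside
  \<open>[t, t + 1]\<close> decay geometrically and contribute \<open>O(\<delta>)\<close> in total.

  Both properties hold with high probability. Switching a pair of edges shows that a fixed set of \<open>k\<close>
  pairs is contained in the random graph with probability at most about \<open>(d/n)^k\<close>; binomial moments turn
  this into an exponential upper tail for the number of edges inside any given set of pairs, and a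
  failure of either property forces some set of pairs to carry too many edges. The union bound
  over vertex sets then succeeds once \<open>d\<close> is large.
\<close>

section \<open>Switchings\<close>

definition pairs :: "nat \<Rightarrow> nat set set" where
  "pairs n = {{u, v} | u v. u < n \<and> v < n \<and> u \<noteq> v}"

definition nbrs :: "nat set set \<Rightarrow> nat \<Rightarrow> nat set" where
  "nbrs E v = {w. {v, w} \<in> E}"

lemma finite_pairs: "finite (pairs n)"
  by (rule finite_subset[of _ "Pow {..<n}"]) (auto simp: pairs_def)

lemma regular_graphs_iff:
  "E \<in> regular_graphs n d \<longleftrightarrow> E \<subseteq> pairs n \<and> (\<forall>v<n. card {e \<in> E. v \<in> e} = d)"
  by (simp add: regular_graphs_def pairs_def)

lemma finite_regular_graphs: "finite (regular_graphs n d)"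
  by (rule finite_subset[of _ "Pow (pairs n)"]) (auto simp: regular_graphs_iff finite_pairs)

lemma regular_graph_finite: "E \<in> regular_graphs n d \<Longrightarrow> finite E"
  using finite_pairs finite_subset by (auto simp: regular_graphs_iff)

lemma pair_in_pairs_iff: "{u, v} \<in> pairs n \<longleftrightarrow> u < n \<and> v < n \<and> u \<noteq> v"
  by (auto simp: pairs_def doubleton_eq_iff)

lemma edge_bounds:
  assumes "E \<in> regular_graphs n d" "{u, v} \<in> E"
  shows "u < n" "v < n" "u \<noteq> v"
proof -
  have "{u, v} \<in> pairs n"
    using assms by (auto simp: regular_graphs_iff)
  then show "u < n" "v < n" "u \<noteq> v"
    by (auto simp: pair_in_pairs_iff)
qed

lemma nbrs_bij:
  assumes "E \<subseteq> pairs n"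
  shows "bij_betw (\<lambda>w. {v, w}) (nbrs E v) {e \<in> E. v \<in> e}"
proof (rule bij_betwI')
  fix e assume "e \<in> {e \<in> E. v \<in> e}"
  moreover from this obtain a b where "e = {a, b}"
    using assms by (auto simp: pairs_def)
  ultimately show "\<exists>w\<in>nbrs E v. e = {v, w}"
    by (auto simp: nbrs_def insert_commute)
qed (auto simp: nbrs_def doubleton_eq_iff)

lemma nbrs_subset: "E \<in> regular_graphs n d \<Longrightarrow> nbrs E v \<subseteq> {..<n}"
  using edge_bounds by (auto simp: nbrs_def)

lemma finite_nbrs: "E \<in> regular_graphs n d \<Longrightarrow> finite (nbrs E v)"
  by (rule finite_subset[OF nbrs_subset]) auto

lemma card_nbrs:
  assumes "E \<in> regular_graphs n d" "v < n"
  shows "card (nbrs E v) = d"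
  using bij_betw_same_card[OF nbrs_bij[of E n v]] assms by (simp add: regular_graphs_iff)

lemma card_nbrs_le:
  assumes "E \<in> regular_graphs n d"
  shows "card (nbrs E v) \<le> d"
proof (cases "v < n")
  case False
  then have "nbrs E v = {}"
    using edge_bounds(1)[OF assms] by (auto simp: nbrs_def)
  then show ?thesis by simp
qed (use card_nbrs[OF assms] in auto)

text \<open>A switching must know which end of its second edge gets attached to \<open>u\<close>, so
  edges are counted with an orientation. Grouping by the first endpoint gives \<open>d\<close> arcs
  per vertex.\<close>

lemma arcs_card:
  assumes "E \<in> regular_graphs n d"
  shows "finite {(x, y). {x, y} \<in> E}" "card {(x, y). {x, y} \<in> E} = n * d"
proof -
  have eq: "{(x, y). {x, y} \<in> E} = Sigma {..<n} (nbrs E)"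
    using edge_bounds[OF assms] by (auto simp: nbrs_def)
  show "finite {(x, y). {x, y} \<in> E}"
    unfolding eq using finite_nbrs[OF assms] by auto
  have "card (Sigma {..<n} (nbrs E)) = (\<Sum>x<n. card (nbrs E x))"
    using finite_nbrs[OF assms] by (subst card_SigmaI) auto
  also have "\<dots> = n * d"
    using card_nbrs[OF assms] by simp
  finally show "card {(x, y). {x, y} \<in> E} = n * d"
    unfolding eq .
qed

lemma arcs_card_le:
  assumes "finite H" "H \<subseteq> pairs n"
  shows "finite {(x, y). {x, y} \<in> H} \<and> card {(x, y). {x, y} \<in> H} \<le> 2 * card H"
  using assms
proof (induction H rule: finite_induct)
  case (insert e H)
  then obtain a b where e: "e = {a, b}"
    by (auto simp: pairs_def)
  have sub: "{(x, y). {x, y} \<in> insert e H} \<subseteq> {(a, b), (b, a)} \<union> {(x, y). {x, y} \<in> H}"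
    using e by (auto simp: doubleton_eq_iff)
  have fin: "finite ({(a, b), (b, a)} \<union> {(x, y). {x, y} \<in> H})"
    using insert by auto
  have "card {(x, y). {x, y} \<in> insert e H} \<le> card ({(a, b), (b, a)} \<union> {(x, y). {x, y} \<in> H})"
    by (rule card_mono[OF fin sub])
  also have "\<dots> \<le> card {(a, b), (b, a)} + card {(x, y). {x, y} \<in> H}"
    by (rule card_Un_le)
  also have "\<dots> \<le> 2 + 2 * card H"
  proof (rule add_mono)
    show "card {(a, b), (b, a)} \<le> 2"
      using card_length[of "[(a, b), (b, a)]"] by simp
  qed (use insert in simp)
  finally show ?case
    using insert finite_subset[OF sub fin] by simp
qed auto

section \<open>The switching operation and double counting with it\<close>

definition switch :: "nat \<Rightarrow> nat \<Rightarrow> nat \<Rightarrow> nat \<Rightarrow> nat set set \<Rightarrow> nat set set" where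
  "switch u v x y E = (E - {{u, v}, {x, y}}) \<union> {{u, x}, {v, y}}"

text \<open>The two removed and the two inserted edges each cover \<open>u\<close>,
  \<open>v\<close>, \<open>x\<close>, \<open>y\<close> exactly once, so degrees do not change; the
  non-adjacency conditions keep the graph simple.\<close>

lemma switch_regular:
  assumes E: "E \<in> regular_graphs n d" and uv: "{u, v} \<in> E" and xy: "{x, y} \<in> E"
    and "x \<noteq> u" "x \<notin> nbrs E u" "y \<noteq> v" "y \<notin> nbrs E v"
  shows "switch u v x y E \<in> regular_graphs n d"
proof -
  \<comment> \<open>\<open>v\<close> is itself a neighbour of \<open>u\<close>, and \<open>u\<close>
    of \<open>v\<close>; hence \<open>x \<noteq> v\<close> and \<open>y \<noteq> u\<close>, and all
    four vertices are distinct.\<close>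
  have dist: "u \<noteq> v" "x \<noteq> y" "x \<noteq> u" "y \<noteq> v" "x \<noteq> v" "y \<noteq> u" and new: "{u, x} \<notin> E" "{v, y} \<notin> E"
    using assms edge_bounds[OF E uv] edge_bounds[OF E xy]
    by (auto simp: nbrs_def insert_commute)
  have bd: "u < n" "v < n" "x < n" "y < n"
    using edge_bounds[OF E uv] edge_bounds[OF E xy] by auto
  have fin: "finite E"
    using regular_graph_finite[OF E] .
  \<comment> \<open>Integer-valued indicator sums make the deletion of edges an honest
    subtraction.\<close>
  have deg: "int (card {e \<in> F. w \<in> e}) = (\<Sum>e\<in>F. of_bool (w \<in> e))" if "finite F" for F :: "nat set set" and w
    using that by (simp add: of_bool_def sum.If_cases Int_def)
  have "card {e \<in> switch u v x y E. w \<in> e} = d" if w: "w < n" for w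
  proof -
    have ends: "(\<Sum>e\<in>{{a, b}, {p, q}}. of_bool (w \<in> e) :: int)
        = of_bool (w = a) + of_bool (w = b) + of_bool (w = p) + of_bool (w = q)"
      if "a \<noteq> b" "p \<noteq> q" "a \<noteq> p" "a \<noteq> q" for a b p q
      using that by (subst sum.insert) (auto simp: doubleton_eq_iff)
    have "int (card {e \<in> switch u v x y E. w \<in> e})
        = (\<Sum>e\<in>E - {{u, v}, {x, y}}. of_bool (w \<in> e)) + (\<Sum>e\<in>{{u, x}, {v, y}}. of_bool (w \<in> e))"
      unfolding switch_def using fin new
      by (subst deg, simp, subst sum.union_disjoint) auto
    also have "(\<Sum>e\<in>E - {{u, v}, {x, y}}. of_bool (w \<in> e))
        = (\<Sum>e\<in>E. of_bool (w \<in> e)) - (\<Sum>e\<in>{{u, v}, {x, y}}. (of_bool (w \<in> e) :: int))"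
      using fin uv xy by (subst sum_diff) auto
    also have "(\<Sum>e\<in>E. of_bool (w \<in> e)) = int d"
      using deg[OF fin, of w] E w by (simp add: regular_graphs_iff)
    also have "(\<Sum>e\<in>{{u, v}, {x, y}}. (of_bool (w \<in> e) :: int)) = (\<Sum>e\<in>{{u, x}, {v, y}}. of_bool (w \<in> e))"
      using ends[of u v x y] ends[of u x v y] dist by (simp only: ac_simps not_False_eq_True)
    finally show ?thesis by simp
  qed
  moreover have "switch u v x y E \<subseteq> pairs n"
    using E bd dist by (auto simp: switch_def regular_graphs_iff pair_in_pairs_iff)
  ultimately show ?thesis
    by (simp add: regular_graphs_iff)
qed

text \<open>With \<open>u\<close>, \<open>v\<close> fixed, the switched graph together with
  \<open>(x, y)\<close> determines the original; this gives the injectivity in the double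
  count.\<close>

lemma switch_inverse:
  assumes "{u, v} \<in> E" "{x, y} \<in> E" "{u, x} \<notin> E" "{v, y} \<notin> E"
  shows "(switch u v x y E - {{u, x}, {v, y}}) \<union> {{u, v}, {x, y}} = E"
  using assms by (auto simp: switch_def)

text \<open>An arc is unusable only if it belongs to \<open>H\<close>, starts in the closed
  neighbourhood of \<open>u\<close>, or ends in that of \<open>v\<close>. Each neighbourhood spoils
  at most \<open>(d + 1) * d\<close> arcs. The additive form avoids truncated subtraction.\<close>

lemma switchable_arcs_card:
  assumes E: "E \<in> regular_graphs n d" and H: "H \<subseteq> pairs n"
  shows "n * d \<le> card {(x, y). {x, y} \<in> E \<and> {x, y} \<notin> H \<and> x \<noteq> u \<and> x \<notin> nbrs E u \<and> y \<noteq> v \<and> y \<notin> nbrs E v}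
      + 2 * card H + 2 * d * (d + 1)"
proof -
  let ?G = "{(x, y). {x, y} \<in> E \<and> {x, y} \<notin> H \<and> x \<noteq> u \<and> x \<notin> nbrs E u \<and> y \<noteq> v \<and> y \<notin> nbrs E v}"
  let ?H = "{(x, y). {x, y} \<in> H}"
  let ?X = "Sigma (insert u (nbrs E u)) (nbrs E)" and ?Y = "Sigma (insert v (nbrs E v)) (nbrs E)"
  have Hf: "finite ?H" "card ?H \<le> 2 * card H"
    using arcs_card_le[OF finite_subset[OF H finite_pairs] H] by auto
  have XY: "finite (Sigma (insert z (nbrs E z)) (nbrs E)) \<and> card (Sigma (insert z (nbrs E z)) (nbrs E)) \<le> d * (d + 1)" for z
  proof -
    have "card (insert z (nbrs E z)) \<le> d + 1"
      using card_nbrs_le[OF E, of z] finite_nbrs[OF E, of z] by (simp add: card_insert_if)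
    moreover have "(\<Sum>a\<in>insert z (nbrs E z). card (nbrs E a)) \<le> card (insert z (nbrs E z)) * d"
      using sum_bounded_above[of "insert z (nbrs E z)" "\<lambda>a. card (nbrs E a)" d] card_nbrs_le[OF E] by simp
    ultimately have "(\<Sum>a\<in>insert z (nbrs E z). card (nbrs E a)) \<le> (d + 1) * d"
      by (meson le_trans mult_le_mono1)
    then show ?thesis
      using finite_nbrs[OF E] by (subst card_SigmaI) (auto simp: mult.commute)
  qed
  have Gf: "finite ?G"
    by (rule finite_subset[OF _ arcs_card(1)[OF E]]) auto
  have sub: "{(x, y). {x, y} \<in> E} \<subseteq> (?G \<union> ?H) \<union> (?X \<union> prod.swap ` ?Y)"
    by (auto simp: nbrs_def insert_commute image_iff)
  have "n * d \<le> card ((?G \<union> ?H) \<union> (?X \<union> prod.swap ` ?Y))"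
    unfolding arcs_card(2)[OF E, symmetric] using Gf Hf XY by (intro card_mono[OF _ sub]) auto
  also have "\<dots> \<le> (card ?G + card ?H) + (card ?X + card ?Y)"
    using card_Un_le card_image_le[of ?Y prod.swap] XY[of v]
    by (meson add_mono le_trans order_refl)
  also have "\<dots> \<le> (card ?G + 2 * card H) + (d * (d + 1) + d * (d + 1))"
    using Hf XY[of u] XY[of v] by (intro add_mono) auto
  finally show ?thesis by simp
qed

text \<open>Double counting of the switchings that destroy \<open>e = {u, v}\<close>. Arcs in
  \<open>H\<close> are barred, so \<open>H\<close> survives. In the resulting graph \<open>x\<close>
  and \<open>y\<close> are neighbours of \<open>u\<close> and \<open>v\<close>, so each graph on the
  right is hit at most \<open>d^2\<close> times. Truncation makes the bound trivial when
  \<open>n\<close> is small.\<close>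

lemma switching_bound:
  assumes H: "H \<subseteq> pairs n" and e: "e \<in> pairs n" "e \<notin> H"
  shows "card {E \<in> regular_graphs n d. insert e H \<subseteq> E} * (n * d - 2 * card H - 2 * d * (d + 1))
      \<le> d\<^sup>2 * card {E \<in> regular_graphs n d. H \<subseteq> E}"
proof -
  obtain u v where uv: "e = {u, v}"
    using e by (auto simp: pairs_def)
  let ?A = "{E \<in> regular_graphs n d. insert e H \<subseteq> E}" and ?B = "{E \<in> regular_graphs n d. H \<subseteq> E}"
  let ?G = "\<lambda>E. {(x, y). {x, y} \<in> E \<and> {x, y} \<notin> H \<and> x \<noteq> u \<and> x \<notin> nbrs E u \<and> y \<noteq> v \<and> y \<notin> nbrs E v}"
  have fin: "finite ?A" "finite ?B"
    using finite_regular_graphs by auto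
  have finG: "finite (?G E)" if "E \<in> regular_graphs n d" for E
    by (rule finite_subset[OF _ arcs_card(1)[OF that]]) auto
  let ?f = "\<lambda>(E, x, y). (switch u v x y E, x, y)"
  have "card ?A * (n * d - 2 * card H - 2 * d * (d + 1)) \<le> (\<Sum>E\<in>?A. card (?G E))"
  proof (subst mult.commute, rule order_trans[OF _ sum_mono])
    show "(n * d - 2 * card H - 2 * d * (d + 1)) \<le> card (?G E)" if "E \<in> ?A" for E
      using switchable_arcs_card[of E n d H u v] that H by simp
  qed simp
  also have "\<dots> = card (Sigma ?A ?G)"
    using fin finG by (subst card_SigmaI) auto
  also have "\<dots> \<le> card (Sigma ?B (\<lambda>E. nbrs E u \<times> nbrs E v))"
  proof (rule card_inj_on_le[of ?f])
    have inv: "E = (switch u v x y E - {{u, x}, {v, y}}) \<union> {{u, v}, {x, y}}"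
      if "(E, x, y) \<in> Sigma ?A ?G" for E x y
      using that uv by (intro switch_inverse[symmetric]) (auto simp: nbrs_def)
    show "inj_on ?f (Sigma ?A ?G)"
    proof (rule inj_onI)
      fix p q assume "p \<in> Sigma ?A ?G" "q \<in> Sigma ?A ?G" "?f p = ?f q"
      moreover obtain E x y where "p = (E, x, y)" by (cases p)
      moreover obtain E' x' y' where "q = (E', x', y')" by (cases q)
      ultimately show "p = q"
        using inv[of E x y] inv[of E' x' y'] by auto
    qed
    show "?f ` Sigma ?A ?G \<subseteq> Sigma ?B (\<lambda>E. nbrs E u \<times> nbrs E v)"
    proof (clarsimp, intro conjI)
      fix E x y
      assume *: "E \<in> regular_graphs n d" "e \<in> E" "H \<subseteq> E" "{x, y} \<in> E" "{x, y} \<notin> H"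
        "x \<noteq> u" "x \<notin> nbrs E u" "y \<noteq> v" "y \<notin> nbrs E v"
      show "switch u v x y E \<in> regular_graphs n d"
        using * uv by (intro switch_regular) auto
      show "H \<subseteq> switch u v x y E"
        using * uv e by (auto simp: switch_def)
      show "x \<in> nbrs (switch u v x y E) u" "y \<in> nbrs (switch u v x y E) v"
        by (auto simp: nbrs_def switch_def)
    qed
    show "finite (Sigma ?B (\<lambda>E. nbrs E u \<times> nbrs E v))"
      using fin finite_nbrs by auto
  qed
  also have "\<dots> = (\<Sum>E\<in>?B. card (nbrs E u) * card (nbrs E v))"
    using fin finite_nbrs by (subst card_SigmaI) (auto simp: card_cartesian_product)
  also have "\<dots> \<le> (\<Sum>E\<in>?B. d * d)"
    by (intro sum_mono mult_le_mono card_nbrs_le) auto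
  finally show ?thesis
    by (simp add: power2_eq_square mult.commute)
qed

text \<open>Inserting the pairs of \<open>H\<close> one at a time costs a factor at most
  \<open>Q\<close> each, where \<open>Q\<close> is close to \<open>d / n\<close>. The common bound
  \<open>K\<close> on the size allows the same \<open>Q\<close> in every step.\<close>

lemma containment_bound:
  fixes Q :: real
  assumes H: "H \<subseteq> pairs n" and K: "card H \<le> K" "2 * K + 2 * d * (d + 1) < n * d"
    and Q: "Q = (real d)\<^sup>2 / (real n * real d - 2 * real K - 2 * real d * (real d + 1))"
  shows "card {E \<in> regular_graphs n d. H \<subseteq> E} \<le> Q ^ card H * card (regular_graphs n d)"
  using finite_subset[OF H finite_pairs] H K(1)
proof (induction H rule: finite_induct)
  case empty
  then show ?case by simp
next
  case (insert e H)
  let ?D = "n * d - 2 * K - 2 * d * (d + 1)"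
  have D: "0 < ?D" "real ?D = real n * real d - 2 * real K - 2 * real d * (real d + 1)"
    using K(2) by (auto simp: of_nat_diff algebra_simps)
  have "card {E \<in> regular_graphs n d. insert e H \<subseteq> E} * ?D
      \<le> card {E \<in> regular_graphs n d. insert e H \<subseteq> E} * (n * d - 2 * card H - 2 * d * (d + 1))"
    using insert by (intro mult_le_mono) auto
  also have "\<dots> \<le> d\<^sup>2 * card {E \<in> regular_graphs n d. H \<subseteq> E}"
    using insert by (intro switching_bound) auto
  finally have "real (card {E \<in> regular_graphs n d. insert e H \<subseteq> E}) * ?D
      \<le> real d ^ 2 * card {E \<in> regular_graphs n d. H \<subseteq> E}"
    by (simp only: of_nat_mult[symmetric] of_nat_power[symmetric] of_nat_le_iff)
  then have "real (card {E \<in> regular_graphs n d. insert e H \<subseteq> E})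
      \<le> Q * card {E \<in> regular_graphs n d. H \<subseteq> E}"
    using D(1) unfolding Q D(2)[symmetric]
    by (simp only: pos_le_divide_eq times_divide_eq_left of_nat_0_less_iff)
  also have "\<dots> \<le> Q * (Q ^ card H * card (regular_graphs n d))"
  proof (rule mult_left_mono)
    show "0 \<le> Q"
      unfolding Q D(2)[symmetric] by simp
  qed (use insert in auto)
  finally show ?case
    using insert by simp
qed

section \<open>Upper tails of edge counts\<close>

text \<open>Division-free form of \<open>C(m,k) / C(x,k) <= (m / (x - k))^k\<close>. The induction
  rests on the absorption identity \<open>(k+1) C(y,k+1) = (y-k) C(y,k)\<close>, applied to both
  binomials.\<close>

lemma binomial_ratio_le: "(m choose k) * (x - k) ^ k \<le> (x choose k) * m ^ k"
proof (induction k)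
  case (Suc k)
  have absorb: "Suc k * (y choose Suc k) = (y - k) * (y choose k)" for y
    by (simp only: binomial_absorption binomial_absorb_comp)
  have "Suc k * ((m choose Suc k) * (x - Suc k) ^ Suc k) = (m - k) * (m choose k) * (x - Suc k) ^ Suc k"
    by (simp only: absorb mult.assoc[symmetric])
  also have "\<dots> \<le> m * (m choose k) * (x - k) ^ Suc k"
    by (intro mult_le_mono power_mono) auto
  also have "\<dots> = m * (x - k) * ((m choose k) * (x - k) ^ k)"
    by simp
  also have "\<dots> \<le> m * (x - k) * ((x choose k) * m ^ k)"
    by (intro mult_le_mono2 Suc)
  also have "\<dots> = (x - k) * (x choose k) * m ^ Suc k"
    by simp
  also have "\<dots> = Suc k * ((x choose Suc k) * m ^ Suc k)"
    by (simp only: absorb mult.assoc[symmetric])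
  finally show ?case
    by (simp only: Suc_mult_le_cancel1)
qed simp

text \<open>Both sides count the pairs \<open>(E, H)\<close> where \<open>H\<close> is a
  \<open>k\<close>-subset of \<open>E \<inter> P\<close>.\<close>

lemma sum_binomial_moments:
  assumes "finite R" "finite P"
  shows "(\<Sum>E\<in>R. card (E \<inter> P) choose k) = (\<Sum>H | H \<subseteq> P \<and> card H = k. card {E \<in> R. H \<subseteq> E})"
proof -
  have "(\<Sum>E\<in>R. card (E \<inter> P) choose k) = (\<Sum>E\<in>R. \<Sum>H | H \<in> {H. H \<subseteq> P \<and> card H = k} \<and> H \<subseteq> E. 1)"
  proof (rule sum.cong)
    fix E
    have "card (E \<inter> P) choose k = card {H. H \<subseteq> E \<inter> P \<and> card H = k}"
      using assms by (subst n_subsets) auto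
    also have "{H. H \<subseteq> E \<inter> P \<and> card H = k} = {H. H \<in> {H. H \<subseteq> P \<and> card H = k} \<and> H \<subseteq> E}"
      by auto
    finally show "card (E \<inter> P) choose k = (\<Sum>H | H \<in> {H. H \<subseteq> P \<and> card H = k} \<and> H \<subseteq> E. 1)"
      by simp
  qed simp
  also have "\<dots> = (\<Sum>H | H \<subseteq> P \<and> card H = k. \<Sum>E | E \<in> R \<and> H \<subseteq> E. 1)"
    using assms by (intro sum.swap_restrict) auto
  finally show ?thesis by simp
qed

text \<open>Markov's inequality for the \<open>k\<close>-th binomial moment: a graph counted on the
  left contributes at least \<open>C(x,k)\<close>, while the moment averages at most
  \<open>C(card P, k) * Q^k\<close>. The order \<open>k\<close> stays free, to be tuned to each
  union bound.\<close>

lemma edge_count_tail: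
  fixes Q M :: real
  assumes P: "P \<subseteq> pairs n" "card P \<le> M" and k: "k < x" "2 * k + 2 * d * (d + 1) < n * d"
    and Q: "Q = (real d)\<^sup>2 / (real n * real d - 2 * real k - 2 * real d * (real d + 1))"
  shows "card {E \<in> regular_graphs n d. x \<le> card (E \<inter> P)}
      \<le> (M * Q / (real x - real k)) ^ k * card (regular_graphs n d)"
proof -
  let ?R = "regular_graphs n d"
  let ?B = "{E \<in> ?R. x \<le> card (E \<inter> P)}"
  have finP: "finite P"
    using P finite_pairs finite_subset by blast
  have "real (2 * k + 2 * d * (d + 1)) < real (n * d)"
    using k by (simp only: of_nat_less_iff)
  then have Q0: "0 \<le> Q"
    unfolding Q by (simp add: algebra_simps)
  have "card ?B * (x choose k) = (\<Sum>E\<in>?B. x choose k)"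
    by simp
  also have "\<dots> \<le> (\<Sum>E\<in>?B. card (E \<inter> P) choose k)"
    by (intro sum_mono binomial_right_mono) auto
  also have "\<dots> \<le> (\<Sum>E\<in>?R. card (E \<inter> P) choose k)"
    using finite_regular_graphs by (intro sum_mono2) auto
  also have "\<dots> = (\<Sum>H | H \<subseteq> P \<and> card H = k. card {E \<in> ?R. H \<subseteq> E})"
    by (rule sum_binomial_moments[OF finite_regular_graphs finP])
  finally have "real (card ?B * (x choose k)) \<le> (\<Sum>H | H \<subseteq> P \<and> card H = k. real (card {E \<in> ?R. H \<subseteq> E}))"
    by (simp only: of_nat_sum[symmetric] of_nat_le_iff)
  also have "\<dots> \<le> (\<Sum>H | H \<subseteq> P \<and> card H = k. Q ^ k * card ?R)"
    using containment_bound[of _ n k d Q] k P Q by (intro sum_mono) auto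
  also have "\<dots> = (card P choose k) * (Q ^ k * card ?R)"
    using finP by (simp add: n_subsets)
  finally have "real (card ?B) * (x choose k) * (real x - real k) ^ k
      \<le> (card P choose k) * (Q ^ k * card ?R) * (real x - real k) ^ k"
    using k by (intro mult_right_mono) auto
  also have "\<dots> = real ((card P choose k) * (x - k) ^ k) * (Q ^ k * card ?R)"
    using k by (simp add: of_nat_diff)
  also have "\<dots> \<le> real ((x choose k) * card P ^ k) * (Q ^ k * card ?R)"
    using Q0 by (intro mult_right_mono of_nat_mono binomial_ratio_le) auto
  also have "\<dots> \<le> real (x choose k) * M ^ k * (Q ^ k * card ?R)"
    using Q0 P by (simp, intro mult_right_mono mult_left_mono power_mono) auto
  finally have "real (x choose k) * (real (card ?B) * (real x - real k) ^ k)
      \<le> real (x choose k) * (M ^ k * Q ^ k * card ?R)"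
    by (simp add: mult_ac)
  then have "real (card ?B) * (real x - real k) ^ k \<le> M ^ k * Q ^ k * card ?R"
    using k by (subst (asm) mult_le_cancel_left_pos) auto
  then show ?thesis
    using k by (simp add: power_divide power_mult_distrib field_simps)
qed

section \<open>Existence of regular graphs\<close>

text \<open>Ensures that the denominator in \<open>prob_Gnd\<close> is nonzero; otherwise the
  quotient would be 0 by convention.\<close>

lemma regular_graphs_nonempty:
  assumes n: "2 * d + 2 \<le> n" and even: "even (n * d)"
  shows "regular_graphs n d \<noteq> {}"
proof -
  \<comment> \<open>circulant graph\<close>
  define h where "h = d div 2"
  \<comment> \<open>The offsets are closed under \<open>j -> n - j\<close>. If \<open>d\<close> is
    odd then \<open>n\<close> is even, and the self-paired offset \<open>n div 2\<close> supplies
    the remaining neighbour.\<close>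
  define S where "S = {1..h} \<union> {n - h..<n} \<union> (if odd d then {n div 2} else {})"
  define E where "E = {{v, (v + j) mod n} | v j. v < n \<and> j \<in> S}"
  have h: "2 * h \<le> d" "h < n div 2" "n div 2 < n - h" "d = 2 * h + of_bool (odd d)"
    using n unfolding h_def by (auto simp: of_bool_def elim: oddE)
  have S: "0 < j" "j < n" if "j \<in> S" for j
    using that h unfolding S_def by (auto split: if_splits)
  have sym: "n - j \<in> S" if "j \<in> S" for j
    using that h even unfolding S_def by (auto split: if_splits elim!: evenE)
  have cardS: "card S = d"
  proof -
    have "card ({1..h} \<union> {n - h..<n}) = 2 * h"
      using h by (subst card_Un_disjoint) auto
    moreover have "n div 2 \<notin> {1..h} \<union> {n - h..<n}"
      using h by auto
    ultimately have "card S = 2 * h + of_bool (odd d)"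
      unfolding S_def by auto
    then show ?thesis using h by simp
  qed
  have wrap: "(v + j) mod n = (if v + j < n then v + j else v + j - n)" if "v < n" "j < n" for v j
    using that by (simp add: mod_if[of "v + j"])
  have sub: "E \<subseteq> pairs n"
  proof
    fix e assume "e \<in> E"
    then obtain v j where "e = {v, (v + j) mod n}" "v < n" "j \<in> S"
      by (auto simp: E_def)
    then show "e \<in> pairs n"
      using S[of j] n by (auto simp: pair_in_pairs_iff wrap)
  qed
  have nb: "nbrs E v = (\<lambda>j. (v + j) mod n) ` S" if v: "v < n" for v
  proof (intro equalityI subsetI)
    fix w assume "w \<in> nbrs E v"
    then obtain v' j where e: "{v, w} = {v', (v' + j) mod n}" "v' < n" "j \<in> S"
      by (auto simp: E_def nbrs_def)
    then consider "v = v'" "w = (v' + j) mod n" | "w = v'" "v = (v' + j) mod n"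
      by (auto simp: doubleton_eq_iff)
    then show "w \<in> (\<lambda>j. (v + j) mod n) ` S"
    proof cases
      case 2
      have "w = (v + (n - j)) mod n"
        using 2 e S[of j] by (simp add: wrap)
      then show ?thesis using sym[OF e(3)] by blast
    qed (use e in auto)
  next
    fix w assume "w \<in> (\<lambda>j. (v + j) mod n) ` S"
    then show "w \<in> nbrs E v"
      using v by (auto simp: E_def nbrs_def)
  qed
  have "card {e \<in> E. v \<in> e} = d" if v: "v < n" for v
  proof -
    have "inj_on (\<lambda>j. (v + j) mod n) S"
    proof (rule inj_onI)
      fix i j assume "i \<in> S" "j \<in> S" "(v + i) mod n = (v + j) mod n"
      then show "i = j"
        using v S[of i] S[of j] by (auto simp: wrap split: if_splits)
    qed
    then have "card (nbrs E v) = d"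
      using cardS by (simp add: nb[OF v] card_image)
    then show ?thesis
      using bij_betw_same_card[OF nbrs_bij[OF sub]] by simp
  qed
  with sub have "E \<in> regular_graphs n d"
    by (simp add: regular_graphs_iff)
  then show ?thesis by blast
qed

section \<open>Lipschitz functions on expanding and mixing graphs\<close>

text \<open>Closed neighbourhoods suit level sets: an upper level set of a Lipschitz function
  together with its neighbours lies in the level set one unit lower.\<close>

definition expands :: "real \<Rightarrow> nat \<Rightarrow> nat set set \<Rightarrow> bool" where
  "expands \<delta> n E \<longleftrightarrow>
     (\<forall>A \<subseteq> {..<n}. real (card A) \<le> \<delta> * real n \<longrightarrow> 2 * card A \<le> card (A \<union> (\<Union>v\<in>A. nbrs E v)))"

definition mixes :: "real \<Rightarrow> nat \<Rightarrow> nat set set \<Rightarrow> bool" where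
  "mixes \<delta> n E \<longleftrightarrow>
     (\<forall>A \<subseteq> {..<n}. \<forall>B \<subseteq> {..<n}. A \<inter> B = {} \<longrightarrow> \<delta> * real n \<le> real (card A) \<longrightarrow> \<delta> * real n \<le> real (card B) \<longrightarrow>
        (\<exists>u\<in>A. \<exists>v\<in>B. {u, v} \<in> E))"

text \<open>By the Lipschitz condition, the closed neighbourhood of the level set at height
  \<open>c + k + 1\<close> lies in the one at \<open>c + k\<close>, and expansion makes it at least
  twice as large.\<close>

lemma upper_levels_halve:
  fixes \<delta> :: real
  assumes E: "E \<in> regular_graphs n d" and exp: "expands \<delta> n E" and lip: "lipschitz E f"
    and top: "card {v. v < n \<and> c < f v} \<le> \<delta> * n"
  shows "card {v. v < n \<and> c + real k < f v} \<le> \<delta> * n / 2 ^ k"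
proof (induction k)
  case (Suc k)
  let ?U = "{v. v < n \<and> c + real (Suc k) < f v}" and ?V = "{v. v < n \<and> c + real k < f v}"
  have "card ?U \<le> card {v. v < n \<and> c < f v}"
    by (intro card_mono) auto
  then have "real (card ?U) \<le> \<delta> * n"
    using top by linarith
  then have "2 * card ?U \<le> card (?U \<union> (\<Union>v\<in>?U. nbrs E v))"
    by (intro exp[unfolded expands_def, rule_format]) auto
  also have "?U \<union> (\<Union>v\<in>?U. nbrs E v) \<subseteq> ?V"
  proof -
    have "w < n \<and> c + real k < f w" if "v \<in> ?U" "{v, w} \<in> E" for v w
    proof -
      have "\<bar>f v - f w\<bar> \<le> 1"
        using lip that by (auto simp: lipschitz_def)
      then show ?thesis
        using that edge_bounds[OF E that(2)] by auto
    qed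
    then show ?thesis by (fastforce simp: nbrs_def)
  qed
  then have "card (?U \<union> (\<Union>v\<in>?U. nbrs E v)) \<le> card ?V"
    by (intro card_mono) auto
  finally have "2 * real (card ?U) \<le> real (card ?V)"
    by linarith
  then have "2 * real (card ?U) \<le> \<delta> * n / 2 ^ k"
    using Suc by (rule order_trans)
  from divide_right_mono[OF this, of 2] show ?case
    by (simp add: mult.commute)
qed (use top in simp)

section \<open>Layer-by-layer summation of the tails\<close>

lemma sum_geometric_weights: "(\<Sum>j<K. (real j + 1) / 2 ^ j) = 4 - (2 * real K + 4) / 2 ^ K"
proof (induction K)
  case (Suc K)
  show ?case
    unfolding sum.lessThan_Suc Suc by (simp add: field_simps)
qed simp

text \<open>For a point at distance \<open>w > 0\<close> outside a unit interval,
  \<open>w^2 + w = (w + 1/2)^2 - 1/4\<close> is the amount by which its squared distance to the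
  midpoint exceeds \<open>1/4\<close>.\<close>

definition excess :: "real \<Rightarrow> real" where
  "excess w = (max w 0)\<^sup>2 + max w 0"

text \<open>The weight \<open>2 * (j + 1)\<close> is the increment of \<open>w^2 + w\<close> from
  \<open>j\<close> to \<open>j + 1\<close>, so the right-hand side is the excess of \<open>w\<close>
  rounded up to an integer.\<close>

lemma excess_layers: "w \<le> real K \<Longrightarrow> excess w \<le> (\<Sum>j<K. if real j < w then 2 * (real j + 1) else 0)"
proof (induction K)
  case (Suc K)
  show ?case
  proof (cases "w \<le> K")
    case False
    have "excess w = w * w + w"
      using False by (simp add: excess_def power2_eq_square)
    also have "\<dots> \<le> (real K + 1) * (real K + 1) + (real K + 1)"
      using False Suc by (intro add_mono mult_mono) auto
    also have "\<dots> = (\<Sum>j<Suc K. 2 * (real j + 1))"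
      by (induction K) (auto simp: algebra_simps)
    also have "\<dots> = (\<Sum>j<Suc K. if real j < w then 2 * (real j + 1) else 0)"
      using False by (intro sum.cong) auto
    finally show ?thesis .
  qed (use Suc in auto)
qed (simp add: excess_def)

lemma total_excess_le:
  fixes \<delta> :: real
  assumes E: "E \<in> regular_graphs n d" and exp: "expands \<delta> n E" and lip: "lipschitz E f"
    and top: "card {v. v < n \<and> c < f v} \<le> \<delta> * n" and "0 \<le> \<delta>"
  shows "(\<Sum>v<n. excess (f v - c)) \<le> 8 * \<delta> * n"
proof -
  \<comment> \<open>\<open>K\<close> dominates every \<open>f v - c\<close>, so finitely many layers
    suffice; inserting 0 keeps the maximum defined for \<open>n = 0\<close>.\<close>
  obtain K :: nat where K: "Max (insert 0 ((\<lambda>v. f v - c) ` {..<n})) \<le> K"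
    using real_arch_simple by blast
  have "(\<Sum>v<n. excess (f v - c)) \<le> (\<Sum>v<n. \<Sum>j<K. if real j < f v - c then 2 * (real j + 1) else 0)"
    using K by (intro sum_mono excess_layers) auto
  also have "\<dots> = (\<Sum>j<K. \<Sum>v<n. if real j < f v - c then 2 * (real j + 1) else 0)"
    by (rule sum.swap)
  also have "\<dots> = (\<Sum>j<K. 2 * (real j + 1) * card {v. v < n \<and> c + real j < f v})"
  proof (rule sum.cong)
    fix j
    have "{..<n} \<inter> {v. real j < f v - c} = {v. v < n \<and> c + real j < f v}"
      by auto
    then show "(\<Sum>v<n. if real j < f v - c then 2 * (real j + 1) else 0)
        = 2 * (real j + 1) * card {v. v < n \<and> c + real j < f v}"
      by (simp add: sum.If_cases)
  qed simp
  also have "\<dots> \<le> (\<Sum>j<K. 2 * (real j + 1) * (\<delta> * n / 2 ^ j))"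
    by (intro sum_mono mult_left_mono upper_levels_halve[OF E exp lip top]) auto
  also have "\<dots> = 2 * \<delta> * n * (\<Sum>j<K. (real j + 1) / 2 ^ j)"
    by (simp add: sum_distrib_left mult_ac)
  \<comment> \<open>The closed form keeps the partial sums at most 4, whatever \<open>K\<close>
    is.\<close>
  also have "\<dots> \<le> 2 * \<delta> * n * 4"
    using \<open>0 \<le> \<delta>\<close> unfolding sum_geometric_weights by (intro mult_left_mono) auto
  finally show ?thesis by simp
qed

text \<open>Take the least value of \<open>f\<close> whose weak sublevel set has at least
  \<open>\<delta> * n\<close> vertices. If its strict sublevel set had more than
  \<open>\<delta> * n\<close>, the largest value there would be a smaller candidate.\<close>

lemma lower_quantile_exists:
  fixes f :: "nat \<Rightarrow> real" and \<delta> :: real and n :: nat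
  assumes "0 < n" "0 < \<delta>" "\<delta> \<le> 1"
  obtains t where "\<delta> * n \<le> card {v. v < n \<and> f v \<le> t}" "card {v. v < n \<and> f v < t} \<le> \<delta> * n"
proof -
  define T where "T = {f v | v. v < n \<and> \<delta> * n \<le> card {u. u < n \<and> f u \<le> f v}}"
  have finT: "finite T"
    unfolding T_def by (rule finite_subset[of _ "f ` {..<n}"]) auto
  let ?m = "Max (f ` {..<n})"
  have "?m \<in> f ` {..<n}"
    using assms by (intro Max_in) auto
  moreover have "{u. u < n \<and> f u \<le> ?m} = {..<n}"
    by auto
  ultimately have "?m \<in> T"
    using assms unfolding T_def by (auto simp: mult_le_cancel_right1)
  then have "Min T \<in> T"
    using finT by (intro Min_in) auto
  then have 1: "\<delta> * n \<le> card {v. v < n \<and> f v \<le> Min T}"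
    unfolding T_def by auto
  have 2: "card {v. v < n \<and> f v < Min T} \<le> \<delta> * n"
  proof (rule ccontr)
    let ?L = "{v. v < n \<and> f v < Min T}"
    assume *: "\<not> card ?L \<le> \<delta> * n"
    have ne: "?L \<noteq> {}"
    proof
      assume "?L = {}"
      with * assms show False by (simp add: mult_less_0_iff)
    qed
    have "Max (f ` ?L) \<in> f ` ?L"
      using ne by (intro Max_in) auto
    then obtain v where v: "v < n" "f v < Min T" "f v = Max (f ` ?L)"
      by auto
    have "{u. u < n \<and> f u \<le> f v} = ?L"
      using v by auto
    then have "f v \<in> T"
      using * v(1) unfolding T_def by auto
    then show False
      using v Min_le[OF finT] by fastforce
  qed
  show ?thesis using that 1 2 by blast
qed

text \<open>The gap between the two sides is the squared distance from \<open>m\<close> to the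
  mean.\<close>

lemma variance_le_second_moment:
  assumes "0 < n"
  shows "variance_unif n f \<le> (\<Sum>v<n. (f v - m)\<^sup>2) / n"
proof -
  have "(\<Sum>v<n. (f v - m)\<^sup>2) = (\<Sum>v<n. (f v)\<^sup>2) - 2 * m * (\<Sum>v<n. f v) + n * m\<^sup>2"
    by (simp add: power2_diff sum.distrib sum_subtractf sum_distrib_left mult_ac)
  moreover have "(b - 2 * m * a + n * m\<^sup>2) / n - (b / n - (a / n)\<^sup>2) = (a / n - m)\<^sup>2" for a b :: real
    using assms by (simp add: field_simps power2_eq_square)
  ultimately have "(\<Sum>v<n. (f v - m)\<^sup>2) / n - variance_unif n f = ((\<Sum>v<n. f v) / n - m)\<^sup>2"
    by (simp only: variance_unif_def)
  then show ?thesis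
    by (metis diff_ge_0_iff_ge zero_le_power2)
qed

lemma lipschitz_variance_le:
  fixes \<delta> :: real
  assumes E: "E \<in> regular_graphs n d" and exp: "expands \<delta> n E" and mix: "mixes \<delta> n E"
    and lip: "lipschitz E f" and "0 < n" "0 < \<delta>" "\<delta> \<le> 1"
  shows "variance_unif n f \<le> 1/4 + 16 * \<delta>"
proof -
  obtain t where t: "\<delta> * n \<le> card {v. v < n \<and> f v \<le> t}" "card {v. v < n \<and> f v < t} \<le> \<delta> * n"
    using assms by (auto intro: lower_quantile_exists[of n \<delta> f])
  \<comment> \<open>Otherwise mixing gives an edge from a value at most \<open>t\<close> to one
    above \<open>t + 1\<close>, against the Lipschitz condition.\<close>
  have "card {v. v < n \<and> t + 1 < f v} \<le> \<delta> * n"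
  proof (rule ccontr)
    assume *: "\<not> card {v. v < n \<and> t + 1 < f v} \<le> \<delta> * n"
    have "\<exists>u\<in>{v. v < n \<and> f v \<le> t}. \<exists>v\<in>{v. v < n \<and> t + 1 < f v}. {u, v} \<in> E"
      by (rule mix[unfolded mixes_def, rule_format]) (use t * in auto)
    then obtain u v where "f u \<le> t" "t + 1 < f v" "{u, v} \<in> E"
      by auto
    moreover from this have "\<bar>f u - f v\<bar> \<le> 1"
      using lip unfolding lipschitz_def by blast
    ultimately show False by linarith
  qed
  then have up: "(\<Sum>v<n. excess (f v - (t + 1))) \<le> 8 * \<delta> * n"
    using assms by (intro total_excess_le[OF E exp lip]) auto
  \<comment> \<open>Negation turns the values below \<open>t\<close> into values above
    \<open>-t\<close>, so the upper-tail bound serves both sides.\<close>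
  have lip': "lipschitz E (\<lambda>v. - f v)"
    using lip by (auto simp: lipschitz_def abs_minus_commute)
  have down: "(\<Sum>v<n. excess (- f v - (- t))) \<le> 8 * \<delta> * n"
    using assms t by (intro total_excess_le[OF E exp lip']) auto
  \<comment> \<open>Outside \<open>[t, t + 1]\<close> this is an equality by the choice of
    \<open>excess\<close>; inside, it says \<open>(f v - t) * (t + 1 - f v) \<ge> 0\<close>.\<close>
  have point: "(f v - (t + 1/2))\<^sup>2 \<le> 1/4 + excess (f v - (t + 1)) + excess (- f v - (- t))" for v
  proof -
    consider "f v < t" | "t + 1 < f v" | "t \<le> f v" "f v \<le> t + 1" by linarith
    then show ?thesis
    proof cases
      case 3
      then have "(f v - t) * (t + 1 - f v) \<ge> 0" by simp
      then show ?thesis using 3 by (simp add: excess_def power2_eq_square algebra_simps)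
    qed (auto simp: excess_def power2_eq_square algebra_simps)
  qed
  have "variance_unif n f \<le> (\<Sum>v<n. (f v - (t + 1/2))\<^sup>2) / n"
    by (rule variance_le_second_moment[OF \<open>0 < n\<close>])
  also have "\<dots> \<le> (\<Sum>v<n. 1/4 + excess (f v - (t + 1)) + excess (- f v - (- t))) / n"
    by (intro divide_right_mono sum_mono point) auto
  also have "\<dots> \<le> (n / 4 + 8 * \<delta> * n + 8 * \<delta> * n) / n"
    using up down by (intro divide_right_mono) (auto simp: sum.distrib)
  also have "\<dots> = 1/4 + 16 * \<delta>"
    using \<open>0 < n\<close> by (simp add: field_simps)
  finally show ?thesis .
qed

section \<open>Expansion of small sets\<close>

definition pairs_on :: "nat set \<Rightarrow> nat set set" where
  "pairs_on S = {e. e \<subseteq> S \<and> card e = 2}"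

definition cross :: "nat set \<Rightarrow> nat set \<Rightarrow> nat set set" where
  "cross A C = (\<lambda>(u, v). {u, v}) ` (A \<times> C)"

lemma pairs_on_subset: "S \<subseteq> {..<n} \<Longrightarrow> pairs_on S \<subseteq> pairs n"
  by (auto simp: pairs_on_def pairs_def card_2_iff)

lemma card_pairs_on_le:
  assumes "finite S"
  shows "real (card (pairs_on S)) \<le> (real (card S))\<^sup>2 / 2"
proof -
  have "card (pairs_on S) = card S choose 2"
    using assms by (simp add: pairs_on_def n_subsets)
  also have "\<dots> = card S * (card S - 1) div 2"
    by (rule choose_two)
  finally have "2 * card (pairs_on S) \<le> card S * (card S - 1)"
    by simp
  also have "\<dots> \<le> card S * card S"
    by simp
  finally have "2 * real (card (pairs_on S)) \<le> real (card S) * real (card S)"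
    by (metis of_nat_le_iff of_nat_mult of_nat_numeral)
  then show ?thesis
    by (simp add: power2_eq_square)
qed

lemma cross_subset: "A \<subseteq> {..<n} \<Longrightarrow> C \<subseteq> {..<n} \<Longrightarrow> A \<inter> C = {} \<Longrightarrow> cross A C \<subseteq> pairs n"
  by (auto simp: cross_def pair_in_pairs_iff)

lemma card_cross_le: "finite A \<Longrightarrow> finite C \<Longrightarrow> card (cross A C) \<le> card A * card C"
  unfolding cross_def by (metis card_cartesian_product card_image_le finite_cartesian_product)

text \<open>Handshake identity localised to \<open>A\<close>: an edge is counted once for each of
  its ends in \<open>A\<close>.\<close>

lemma degree_sum:
  assumes E: "E \<in> regular_graphs n d" and A: "A \<subseteq> {..<n}"
  shows "d * card A = (\<Sum>e\<in>E. card (e \<inter> A))"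
proof -
  have finA: "finite A"
    using A finite_subset by blast
  have "d * card A = (\<Sum>v\<in>A. card {e \<in> E. v \<in> e})"
    using E A by (simp add: regular_graphs_iff subset_iff)
  also have "\<dots> = (\<Sum>v\<in>A. \<Sum>e | e \<in> E \<and> v \<in> e. 1)"
    by simp
  also have "\<dots> = (\<Sum>e\<in>E. \<Sum>v | v \<in> A \<and> v \<in> e. 1)"
    using finA regular_graph_finite[OF E] by (rule sum.swap_restrict)
  also have "\<dots> = (\<Sum>e\<in>E. card (e \<inter> A))"
    by (simp add: Int_def conj_commute)
  finally show ?thesis .
qed

text \<open>Suppose the closed neighbourhood \<open>W\<close> of \<open>A\<close> has fewer than
  \<open>2 * card A\<close> vertices. Every edge meeting \<open>A\<close> lies inside
  \<open>W\<close>, and there are at least \<open>d * card A / 2\<close> of them, more than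
  \<open>d * card W / 4\<close>. Sparsity allows fewer than \<open>2 * (d div 8) * card W\<close>,
  which is at most that.\<close>

lemma sparse_imp_expands:
  fixes \<delta> :: real
  assumes E: "E \<in> regular_graphs n d"
    and sparse: "\<And>S. S \<subseteq> {..<n} \<Longrightarrow> S \<noteq> {} \<Longrightarrow> card S \<le> 2 * \<delta> * n \<Longrightarrow>
      card (E \<inter> pairs_on S) < 2 * (d div 8) * card S"
  shows "expands \<delta> n E"
  unfolding expands_def
proof (intro allI impI, rule ccontr)
  fix A assume A: "A \<subseteq> {..<n}" "card A \<le> \<delta> * n"
  let ?W = "A \<union> (\<Union>v\<in>A. nbrs E v)"
  assume "\<not> 2 * card A \<le> card ?W"
  then have W: "card ?W < 2 * card A" by simp
  have Wn: "?W \<subseteq> {..<n}"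
    using A nbrs_subset[OF E] by auto
  have finE: "finite E"
    using regular_graph_finite[OF E] .
  have edge: "card e = 2" "e \<inter> A \<noteq> {} \<Longrightarrow> e \<subseteq> ?W" if eE: "e \<in> E" for e
  proof -
    obtain u v where e: "e = {u, v}" "u \<noteq> v"
      using eE E unfolding regular_graphs_iff pairs_def by blast
    then show "card e = 2" by simp
    assume "e \<inter> A \<noteq> {}"
    then show "e \<subseteq> ?W"
      using eE e by (auto simp: nbrs_def insert_commute)
  qed
  have "d * card A = (\<Sum>e\<in>E. card (e \<inter> A))"
    by (rule degree_sum[OF E A(1)])
  also have "\<dots> = (\<Sum>e | e \<in> E \<and> e \<inter> A \<noteq> {}. card (e \<inter> A))"
    using finE by (intro sum.mono_neutral_right) auto
  also have "\<dots> \<le> (\<Sum>e | e \<in> E \<and> e \<inter> A \<noteq> {}. 2)"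
  proof (rule sum_mono)
    fix e assume "e \<in> {e. e \<in> E \<and> e \<inter> A \<noteq> {}}"
    then have "card e = 2" using edge by auto
    then show "card (e \<inter> A) \<le> 2"
      using card_mono[of e "e \<inter> A"] card.infinite by fastforce
  qed
  also have "\<dots> = 2 * card {e \<in> E. e \<inter> A \<noteq> {}}"
    by simp
  also have "card {e \<in> E. e \<inter> A \<noteq> {}} \<le> card (E \<inter> pairs_on ?W)"
    using finE edge by (intro card_mono) (auto simp: pairs_on_def)
  also have "\<dots> < 2 * (d div 8) * card ?W"
    \<comment> \<open>\<open>W\<close> has fewer than \<open>2 * \<delta> * n\<close> vertices, and
      it is nonempty since \<open>A\<close> is.\<close>
    using W A by (intro sparse Wn) auto
  finally have "d * card A < 4 * (d div 8) * card ?W"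
    by simp
  also have "\<dots> \<le> 4 * (d div 8) * (2 * card A)"
    using W by (intro mult_le_mono) auto
  also have "\<dots> = 8 * (d div 8) * card A"
    by simp
  also have "\<dots> \<le> d * card A"
    by (intro mult_le_mono) auto
  finally show False by simp
qed

text \<open>Tail bound with threshold \<open>2 * \<kappa> * s\<close> and moment order
  \<open>\<kappa> * s\<close>, where \<open>\<kappa> = d div 8\<close>. With
  \<open>Q \<le> 2 * d / n\<close> and \<open>d \<le> 16 * \<kappa>\<close> the base is at most
  \<open>16 * s / n\<close>.\<close>

lemma dense_set_bound:
  assumes S: "S \<subseteq> {..<n}" "S \<noteq> {}" and d: "8 \<le> d" and n: "8 * (d + 1) \<le> n"
  shows "card {E \<in> regular_graphs n d. 2 * (d div 8) * card S \<le> card (E \<inter> pairs_on S)}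
      \<le> (16 * real (card S) / n) ^ ((d div 8) * card S) * card (regular_graphs n d)"
proof -
  define \<kappa> where "\<kappa> = d div 8"
  define s where "s = card S"
  define Q where "Q = (real d)\<^sup>2 / (real n * real d - 2 * real (\<kappa> * s) - 2 * real d * (real d + 1))"
  have finS: "finite S" using S finite_subset by blast
  have s: "0 < s" "s \<le> n"
    using S finS card_mono[OF _ S(1)] by (auto simp: s_def card_gt_0_iff)
  have \<kappa>: "0 < \<kappa>" "8 * \<kappa> \<le> d" "d \<le> 16 * \<kappa>"
    using d unfolding \<kappa>_def by presburger+
  have "8 * (\<kappa> * s) \<le> d * n"
    using mult_le_mono[OF \<kappa>(2) s(2)] by (simp add: mult.assoc)
  then have k: "real (8 * (\<kappa> * s)) \<le> real (d * n)"
    by (simp only: of_nat_le_iff)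
  have "d * (8 * (d + 1)) \<le> d * n"
    using n by (intro mult_le_mono) auto
  then have dd: "real (d * (8 * (d + 1))) \<le> real (d * n)"
    by (simp only: of_nat_le_iff)
  have pos: "0 < real n * real d" using d n by auto
  \<comment> \<open>Each of the two corrections costs at most a quarter of
    \<open>n * d\<close>.\<close>
  have D: "real n * real d / 2 \<le> real n * real d - 2 * real (\<kappa> * s) - 2 * real d * (real d + 1)"
    using k dd by (simp add: algebra_simps)
  then have Dpos: "0 < real n * real d - 2 * real (\<kappa> * s) - 2 * real d * (real d + 1)"
    using pos by linarith
  have Q: "Q \<le> (real d)\<^sup>2 / (real n * real d / 2)"
    unfolding Q_def using pos by (intro divide_left_mono D mult_pos_pos Dpos) auto
  also have "\<dots> = 2 * real d / n"
    using d by (simp add: power2_eq_square)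
  finally have Q: "Q \<le> 2 * real d / n" .
  have Q0: "0 \<le> Q"
    unfolding Q_def by (intro divide_nonneg_nonneg less_imp_le[OF Dpos]) auto
  have "2 * real (\<kappa> * s) + 2 * real d * (real d + 1) < real n * real d"
    using Dpos by linarith
  then have "real (2 * (\<kappa> * s) + 2 * d * (d + 1)) < real (n * d)"
    by (simp add: algebra_simps)
  then have cond: "2 * (\<kappa> * s) + 2 * d * (d + 1) < n * d"
    by (simp only: of_nat_less_iff)
  have lt: "\<kappa> * s < 2 * \<kappa> * s" using s \<kappa> by simp
  have "card {E \<in> regular_graphs n d. 2 * \<kappa> * s \<le> card (E \<inter> pairs_on S)}
      \<le> (((real s)\<^sup>2 / 2) * Q / (real (2 * \<kappa> * s) - real (\<kappa> * s))) ^ (\<kappa> * s) * card (regular_graphs n d)"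
    using card_pairs_on_le[OF finS] unfolding s_def[symmetric]
    by (intro edge_count_tail[OF pairs_on_subset[OF S(1)] _ lt cond Q_def])
  also have "\<dots> \<le> (16 * real s / n) ^ (\<kappa> * s) * card (regular_graphs n d)"
  proof (intro mult_right_mono power_mono)
    have "((real s)\<^sup>2 / 2) * Q / (real (2 * \<kappa> * s) - real (\<kappa> * s)) = real s * Q / (2 * real \<kappa>)"
      using s \<kappa> by (simp add: power2_eq_square field_simps)
    also have "\<dots> \<le> real s * (2 * real d / n) / (2 * real \<kappa>)"
      using Q by (intro divide_right_mono mult_left_mono) auto
    also have "\<dots> = real s * real d / (n * real \<kappa>)"
      by simp
    also have "\<dots> \<le> real s * (16 * real \<kappa>) / (n * real \<kappa>)"
      using \<kappa> by (intro divide_right_mono mult_left_mono) auto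
    also have "\<dots> = 16 * real s / n"
      using \<kappa> by simp
    finally show "((real s)\<^sup>2 / 2) * Q / (real (2 * \<kappa> * s) - real (\<kappa> * s)) \<le> 16 * real s / n" .
  qed (use Q0 lt in auto)
  finally show ?thesis unfolding \<kappa>_def s_def .
qed

text \<open>A single term of the expansion of \<open>(1 + y)^n\<close> at \<open>y = s / n\<close>
  is at most the whole, hence at most \<open>e^s\<close>; then \<open>e\<close> is rounded up to
  3.\<close>

lemma binomial_le_power_3:
  assumes "0 < s" "s \<le> n"
  shows "real (n choose s) \<le> (3 * real n / s) ^ s"
proof -
  define y where "y = real s / n"
  have y: "0 < y" using assms by (simp add: y_def)
  have "real (n choose s) * y ^ s = real (n choose s) * y ^ s * 1 ^ (n - s)"
    by simp
  also have "\<dots> \<le> (\<Sum>k\<le>n. real (n choose k) * y ^ k * 1 ^ (n - k))"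
    using assms y by (intro member_le_sum) auto
  also have "\<dots> = (1 + y) ^ n"
    using binomial_ring[of y 1 n] by (simp add: add.commute)
  also have "\<dots> \<le> exp y ^ n"
    using y exp_ge_add_one_self[of y] by (intro power_mono) auto
  also have "\<dots> = exp 1 ^ s"
    using assms by (simp add: y_def flip: exp_of_nat_mult)
  also have "\<dots> \<le> 3 ^ s"
    using exp_le by (intro power_mono) auto
  finally have "real (n choose s) \<le> 3 ^ s / y ^ s"
    using y by (simp add: field_simps)
  also have "\<dots> = (3 * real n / s) ^ s"
    using assms by (simp add: y_def power_divide power_mult_distrib)
  finally show ?thesis .
qed

text \<open>Put \<open>r = 16 * s / n \<le> 1 / 96\<close>. The binomial is at most
  \<open>(48 / r)^s\<close>, so three factors \<open>r^s\<close> leave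
  \<open>(48 * r^2)^s \<le> (r / 2)^s\<close>. One factor \<open>r\<close> is kept for decay in
  \<open>n\<close>, and \<open>2^s\<close> makes the sum over \<open>s\<close> converge.\<close>

lemma dense_union_term:
  assumes s: "0 < s" "1536 * real s \<le> n" and "3 \<le> \<kappa>"
  shows "real (n choose s) * (16 * real s / n) ^ (\<kappa> * s) \<le> (16 / n) * (real s / 2 ^ s)"
proof -
  define r where "r = 16 * real s / n"
  have n: "0 < real n" "s \<le> n" using s by (auto intro: ccontr)
  have r: "0 < r" "96 * r \<le> 1"
    using s n by (auto simp: r_def field_simps)
  have "real (n choose s) * r ^ (\<kappa> * s) \<le> (3 * real n / s) ^ s * r ^ (3 * s)"
    using r assms binomial_le_power_3[OF s(1) n(2)] by (intro mult_mono power_decreasing) auto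
  also have "3 * real n / s = 48 / r"
    using s n by (simp add: r_def)
  also have "(48 / r) ^ s * r ^ (3 * s) = (48 / r * r ^ 3) ^ s"
    by (simp only: power_mult power_mult_distrib)
  also have "48 / r * r ^ 3 = 48 * r * r"
    using r by (simp add: power3_eq_cube)
  also have "(48 * r * r) ^ s \<le> (1 / 2 * r) ^ s"
    using r by (intro power_mono mult_right_mono) auto
  also have "\<dots> = r ^ s / 2 ^ s"
    by (simp add: power_divide)
  also have "\<dots> \<le> r ^ 1 / 2 ^ s"
    using r s by (intro divide_right_mono power_decreasing) auto
  also have "\<dots> = (16 / n) * (real s / 2 ^ s)"
    by (simp add: r_def)
  finally show ?thesis unfolding r_def .
qed

text \<open>Union bound over all vertex sets of size at most \<open>2 * \<delta> * n\<close>. The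
  cap on \<open>\<delta>\<close> gives \<open>1536 * s \<le> n\<close>, and
  \<open>24 \<le> d\<close> gives \<open>3 \<le> d div 8\<close>.\<close>

lemma not_expands_bound:
  fixes \<delta> :: real
  assumes \<delta>: "0 < \<delta>" "\<delta> \<le> 1 / 3072" and d: "24 \<le> d" and n: "8 * (d + 1) \<le> n"
  shows "card {E \<in> regular_graphs n d. \<not> expands \<delta> n E} \<le> 32 / n * card (regular_graphs n d)"
proof -
  let ?R = "regular_graphs n d" and ?m = "nat \<lfloor>2 * \<delta> * n\<rfloor>"
  let ?bad = "\<lambda>S. {E \<in> ?R. 2 * (d div 8) * card S \<le> card (E \<inter> pairs_on S)}"
  let ?I = "\<lambda>s. {S. S \<subseteq> {..<n} \<and> card S = s}"
  have "{E \<in> ?R. \<not> expands \<delta> n E} \<subseteq> (\<Union>s\<in>{1..?m}. \<Union>S\<in>?I s. ?bad S)"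
  proof
    fix E assume E: "E \<in> {E \<in> ?R. \<not> expands \<delta> n E}"
    then obtain S where S: "S \<subseteq> {..<n}" "S \<noteq> {}" "card S \<le> 2 * \<delta> * n"
        "\<not> card (E \<inter> pairs_on S) < 2 * (d div 8) * card S"
      using sparse_imp_expands[of E n d \<delta>] by blast
    moreover have "finite S" using S finite_subset by blast
    ultimately have "card S \<in> {1..?m}"
      by (auto simp: card_gt_0_iff Suc_le_eq le_nat_floor)
    then show "E \<in> (\<Union>s\<in>{1..?m}. \<Union>S\<in>?I s. ?bad S)"
      using S E by (intro UN_I[of "card S"] UN_I[of S]) auto
  qed
  then have "card {E \<in> ?R. \<not> expands \<delta> n E} \<le> card (\<Union>s\<in>{1..?m}. \<Union>S\<in>?I s. ?bad S)"
    using finite_regular_graphs by (intro card_mono) auto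
  also have "\<dots> \<le> (\<Sum>s\<in>{1..?m}. card (\<Union>S\<in>?I s. ?bad S))"
    by (rule card_UN_le) simp
  also have "\<dots> \<le> (\<Sum>s\<in>{1..?m}. \<Sum>S\<in>?I s. card (?bad S))"
    by (intro sum_mono card_UN_le) auto
  finally have "real (card {E \<in> ?R. \<not> expands \<delta> n E}) \<le> (\<Sum>s\<in>{1..?m}. \<Sum>S\<in>?I s. real (card (?bad S)))"
    by (simp only: of_nat_sum[symmetric] of_nat_le_iff)
  also have "\<dots> \<le> (\<Sum>s\<in>{1..?m}. \<Sum>S\<in>?I s. (16 * real s / n) ^ ((d div 8) * s) * card ?R)"
  proof (intro sum_mono)
    fix s S assume "s \<in> {1..?m}" "S \<in> ?I s"
    then have "S \<subseteq> {..<n}" "S \<noteq> {}" "card S = s" by auto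
    then show "real (card (?bad S)) \<le> (16 * real s / n) ^ ((d div 8) * s) * card ?R"
      using dense_set_bound[of S n d] d n by auto
  qed
  also have "\<dots> = (\<Sum>s\<in>{1..?m}. real (n choose s) * (16 * real s / n) ^ ((d div 8) * s) * card ?R)"
    by (simp add: n_subsets mult.assoc)
  also have "\<dots> \<le> (\<Sum>s\<in>{1..?m}. (16 / n) * (real s / 2 ^ s) * card ?R)"
  proof (intro sum_mono mult_right_mono dense_union_term)
    fix s assume "s \<in> {1..?m}"
    then have "real s \<le> 2 * \<delta> * n" "0 < s"
      using \<delta> by (auto simp: le_nat_iff le_floor_iff)
    moreover have "2 * \<delta> * n \<le> 2 * (1 / 3072) * n"
      using \<delta> by (intro mult_right_mono mult_left_mono) auto
    ultimately show "1536 * real s \<le> n" "0 < s" by auto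
  qed (use d in auto)
  also have "\<dots> = (8 / n) * card ?R * (\<Sum>s\<in>{1..?m}. 2 * (real s / 2 ^ s))"
    by (simp add: sum_distrib_left mult_ac)
  \<comment> \<open>Index shift \<open>s = j + 1\<close>.\<close>
  also have "(\<Sum>s\<in>{1..?m}. 2 * (real s / 2 ^ s)) = (\<Sum>j<?m. (real j + 1) / 2 ^ j)"
    by (rule sum.reindex_bij_witness[of _ Suc "\<lambda>s. s - 1"]) (auto simp: field_simps of_nat_diff simp flip: power_Suc)
  also have "(8 / n) * card ?R * \<dots> \<le> (8 / n) * card ?R * 4"
    unfolding sum_geometric_weights by (intro mult_left_mono) auto
  finally show ?thesis by simp
qed

section \<open>Edges between large sets\<close>

text \<open>The natural size of \<open>card (E \<inter> P)\<close> is about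
  \<open>d * M / n\<close>. A moment of order \<open>L * n\<close> is large enough for an
  exponential bound, yet so small against the threshold that half of the surplus
  \<open>\<delta>\<close> survives all losses.\<close>

lemma edge_count_concentration:
  fixes \<delta> M :: real
  assumes P: "P \<subseteq> pairs n" "card P \<le> M" and M: "\<delta>\<^sup>2 * (real n)\<^sup>2 / 2 \<le> M" "M \<le> (real n)\<^sup>2 / 2"
    and \<delta>: "0 < \<delta>" "\<delta> \<le> 1" and L: "32 * real L \<le> \<delta> ^ 3 * d" and d: "0 < d"
    and n: "32 * (real d + 1) \<le> \<delta> * n"
  shows "card {E \<in> regular_graphs n d. (1 + \<delta>) * d * M / n \<le> card (E \<inter> P)}
      \<le> (1 / (1 + \<delta> / 2)) ^ (L * n) * card (regular_graphs n d)"
proof -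
  define y where "y = (1 + \<delta>) * d * M / n"
  define x where "x = nat \<lceil>y\<rceil>"
  define k where "k = L * n"
  \<comment> \<open>\<open>\<eta>\<close> is the unit of relative loss: \<open>3 * \<eta>\<close> in
    the denominator of \<open>Q\<close> and \<open>\<eta>\<close> in \<open>x - k\<close>, together
    at most \<open>\<delta> / 4\<close>.\<close>
  define \<eta> where "\<eta> = \<delta> / 16"
  define Q where "Q = (real d)\<^sup>2 / (real n * real d - 2 * real k - 2 * real d * (real d + 1))"
  have \<eta>: "0 < \<eta>" "\<eta> \<le> 1 / 16" using \<delta> by (auto simp: \<eta>_def)
  have "0 < \<delta> * n" using n by (smt (verit) of_nat_0_le_iff)
  then have n0: "0 < n" using \<delta> by (simp add: zero_less_mult_iff)
  have M0: "0 < M"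
    using M(1) \<delta> n0 by (smt (verit) divide_pos_pos mult_pos_pos of_nat_0_less_iff zero_less_power)
  have y0: "0 < y"
    unfolding y_def using M0 \<delta> n0 d by (intro divide_pos_pos mult_pos_pos) auto
  have x: "y \<le> real x"
    unfolding x_def by linarith
  \<comment> \<open>The lower bound on \<open>M\<close> makes \<open>y\<close> at least
    \<open>d * \<delta>^2 * n / 2\<close>, which is what the hypothesis on \<open>L\<close> is
    scaled to.\<close>
  have k: "real k \<le> \<eta> * y"
  proof -
    have "real k \<le> \<delta> ^ 3 * d / 32 * n"
      unfolding k_def of_nat_mult using L by (intro mult_right_mono) auto
    also have "\<dots> = \<eta> * (1 * real d * (\<delta>\<^sup>2 * (real n)\<^sup>2 / 2) / n)"
      using n0 by (simp add: \<eta>_def power2_eq_square power3_eq_cube)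
    also have "\<dots> \<le> \<eta> * y"
      unfolding y_def using \<eta> \<delta> M M0
      by (intro mult_left_mono[of _ _ \<eta>] divide_right_mono mult_mono[of _ "(1 + \<delta>) * d"] mult_right_mono) auto
    finally show ?thesis .
  qed
  \<comment> \<open>Here the upper bound on \<open>M\<close> enters: with
    \<open>1 + \<delta> \<le> 2\<close> it gives \<open>y \<le> n * d\<close>.\<close>
  have k2: "2 * real k \<le> 2 * \<eta> * (real n * real d)"
  proof -
    have "y \<le> (1 + 1) * real d * ((real n)\<^sup>2 / 2) / n"
      unfolding y_def using \<delta> M M0
      by (intro divide_right_mono mult_mono[of "(1 + \<delta>) * d"] mult_right_mono) auto
    also have "\<dots> = real n * real d"
      using n0 by (simp add: power2_eq_square)
    finally have "\<eta> * y \<le> \<eta> * (real n * real d)"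
      using \<eta> by (intro mult_left_mono) auto
    then show ?thesis using k by linarith
  qed
  have dd: "2 * real d * (real d + 1) \<le> \<eta> * (real n * real d)"
  proof -
    have "real d * (32 * (real d + 1)) \<le> real d * (\<delta> * n)"
      using n by (intro mult_left_mono) auto
    then show ?thesis by (simp add: \<eta>_def algebra_simps)
  qed
  have nd: "0 < real n * real d" using n0 d by simp
  have D: "(1 - 3 * \<eta>) * (real n * real d) \<le> real n * real d - 2 * real k - 2 * real d * (real d + 1)"
    using k2 dd by (simp add: algebra_simps)
  have D1: "0 < (1 - 3 * \<eta>) * (real n * real d)"
    using \<eta> by (intro mult_pos_pos[OF _ nd]) auto
  have Dpos: "0 < real n * real d - 2 * real k - 2 * real d * (real d + 1)"
    using D D1 by linarith
  have Q0: "0 \<le> Q"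
    unfolding Q_def by (intro divide_nonneg_nonneg less_imp_le[OF Dpos]) auto
  have Q: "Q \<le> (real d)\<^sup>2 / ((1 - 3 * \<eta>) * (real n * real d))"
    unfolding Q_def by (intro divide_left_mono D mult_pos_pos Dpos D1) auto
  have "real (2 * k + 2 * d * (d + 1)) < real (n * d)"
    using Dpos by (simp add: algebra_simps)
  then have cond: "2 * k + 2 * d * (d + 1) < n * d"
    by (simp only: of_nat_less_iff)
  have xk: "(1 - \<eta>) * y \<le> real x - real k"
    using x k by (simp add: algebra_simps)
  have xk0: "0 < (1 - \<eta>) * y"
    using \<eta> y0 by (intro mult_pos_pos) auto
  have lt: "k < x"
    using xk xk0 by linarith
  have sub: "{E \<in> regular_graphs n d. y \<le> card (E \<inter> P)} \<subseteq> {E \<in> regular_graphs n d. x \<le> card (E \<inter> P)}"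
    by (auto simp: x_def nat_le_iff ceiling_le_iff)
  have "real (card {E \<in> regular_graphs n d. y \<le> card (E \<inter> P)})
      \<le> real (card {E \<in> regular_graphs n d. x \<le> card (E \<inter> P)})"
    using finite_regular_graphs by (intro of_nat_mono card_mono sub) auto
  also have "\<dots> \<le> (M * Q / (real x - real k)) ^ k * card (regular_graphs n d)"
    by (rule edge_count_tail[OF P lt cond Q_def])
  also have "\<dots> \<le> (1 / (1 + \<delta> / 2)) ^ k * card (regular_graphs n d)"
  proof (intro mult_right_mono power_mono)
    have "M * Q / (real x - real k) \<le> M * ((real d)\<^sup>2 / ((1 - 3 * \<eta>) * (real n * real d))) / ((1 - \<eta>) * y)"
      using M0 Q Q0 xk xk0 by (intro frac_le mult_left_mono mult_nonneg_nonneg) auto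
    also have "\<dots> = 1 / ((1 - 3 * \<eta>) * ((1 - \<eta>) * (1 + \<delta>)))"
      using M0 n0 d \<eta> \<delta> by (simp add: y_def power2_eq_square)
    also have "\<dots> \<le> 1 / (1 + \<delta> / 2)"
    proof (rule divide_left_mono)
      have "(1 - 3 * \<eta>) * (1 - \<eta>) \<ge> 1 - 4 * \<eta>"
        using \<eta> by (simp add: algebra_simps)
      then have "(1 - 4 * \<eta>) * (1 + \<delta>) \<le> (1 - 3 * \<eta>) * (1 - \<eta>) * (1 + \<delta>)"
        using \<delta> by (intro mult_right_mono) auto
      moreover have "1 + \<delta> / 2 \<le> (1 - 4 * \<eta>) * (1 + \<delta>)"
      proof -
        have "(1 - 4 * \<eta>) * (1 + \<delta>) = 1 + \<delta> / 2 + \<delta> * (1 - \<delta>) / 4"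
          by (simp add: \<eta>_def field_simps)
        moreover have "0 \<le> \<delta> * (1 - \<delta>)" using \<delta> by simp
        ultimately show ?thesis by linarith
      qed
      ultimately show "1 + \<delta> / 2 \<le> (1 - 3 * \<eta>) * ((1 - \<eta>) * (1 + \<delta>))"
        by (simp only: mult.assoc)
    qed (use \<eta> \<delta> in \<open>auto intro!: mult_pos_pos\<close>)
    finally show "M * Q / (real x - real k) \<le> 1 / (1 + \<delta> / 2)" .
    show "0 \<le> M * Q / (real x - real k)"
      using M0 Q0 lt by auto
  qed auto
  finally show ?thesis unfolding y_def k_def .
qed

text \<open>Both sets are shrunk to the same exact size, so that one threshold serves all pairs in
  the union bound.\<close>

lemma not_mixes_witness:
  fixes \<delta> :: real
  assumes "\<not> mixes \<delta> n E"
  obtains A B where "A \<subseteq> {..<n}" "B \<subseteq> {..<n}" "A \<inter> B = {}"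
    "card A = nat \<lceil>\<delta> * n\<rceil>" "card B = nat \<lceil>\<delta> * n\<rceil>" "\<And>u v. u \<in> A \<Longrightarrow> v \<in> B \<Longrightarrow> {u, v} \<notin> E"
proof -
  obtain A B where AB: "A \<subseteq> {..<n}" "B \<subseteq> {..<n}" "A \<inter> B = {}" "\<delta> * n \<le> card A" "\<delta> * n \<le> card B"
    "\<And>u v. u \<in> A \<Longrightarrow> v \<in> B \<Longrightarrow> {u, v} \<notin> E"
    using assms unfolding mixes_def by blast
  have "nat \<lceil>\<delta> * n\<rceil> \<le> card A" "nat \<lceil>\<delta> * n\<rceil> \<le> card B"
    using AB by (auto simp: nat_le_iff ceiling_le_iff)
  then obtain A' B' where "A' \<subseteq> A" "card A' = nat \<lceil>\<delta> * n\<rceil>" "B' \<subseteq> B" "card B' = nat \<lceil>\<delta> * n\<rceil>"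
    by (meson obtain_subset_with_card_n)
  then show ?thesis
    using AB(1-3) AB(6) by (intro that[of A' B']) blast+
qed

text \<open>If there are no edges between \<open>A\<close> and \<open>B\<close>, then all \<open>d |A|\<close> edge ends at \<open>A\<close> are spent on
  pairs avoiding \<open>B\<close>, so one of the two kinds of pairs carries more edges than its size suggests.\<close>
lemma separated_sets_excess:
  fixes \<delta> :: real
  assumes E: "E \<in> regular_graphs n d"
    and AB: "A \<subseteq> {..<n}" "B \<subseteq> {..<n}" "A \<inter> B = {}"
    and sep: "\<And>u v. u \<in> A \<Longrightarrow> v \<in> B \<Longrightarrow> {u, v} \<notin> E"
    and \<delta>: "0 < \<delta>" "\<delta> * n \<le> card A" and n: "0 < n"
  shows "(1 + \<delta>) * d * (real (card A) * (real n - 2 * real (card A))) / n \<le> card (E \<inter> cross A ({..<n} - A - B))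
    \<or> (1 + \<delta>) * d * ((real (card A))\<^sup>2 / 2) / n \<le> card (E \<inter> pairs_on A)"
proof (rule ccontr)
  let ?C = "{..<n} - A - B"
  define a where "a = real (card A)"
  have finE: "finite E"
    using regular_graph_finite[OF E] .
  have "0 < \<delta> * n" using \<delta> n by simp
  then have a: "0 < a" using \<delta> unfolding a_def by linarith
  assume "\<not> ?thesis"
  then have less: "real (card (E \<inter> cross A ?C)) < (1 + \<delta>) * d * (a * (real n - 2 * a)) / n"
      "real (card (E \<inter> pairs_on A)) < (1 + \<delta>) * d * (a\<^sup>2 / 2) / n"
    by (auto simp: a_def)
  have "d * card A = (\<Sum>e\<in>E. card (e \<inter> A))"
    by (rule degree_sum[OF E AB(1)])
  \<comment> \<open>An edge with exactly one end in \<open>A\<close> has its other end outside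
    \<open>B\<close>, hence lies in \<open>cross\<close>; an edge inside \<open>A\<close> counts
    twice.\<close>
  also have "\<dots> \<le> (\<Sum>e\<in>E. of_bool (e \<in> cross A ?C) + 2 * of_bool (e \<in> pairs_on A))"
  proof (rule sum_mono)
    fix e assume e: "e \<in> E"
    then obtain u v where uv: "e = {u, v}" "u \<noteq> v" "u < n" "v < n"
      using E unfolding regular_graphs_iff pairs_def by blast
    have cr: "{p, q} \<in> cross A ?C" if "p \<in> A" "q \<notin> A" "q < n" "{p, q} \<in> E" for p q
      using that sep by (auto simp: cross_def)
    consider "u \<in> A" "v \<in> A" | "u \<in> A" "v \<notin> A" | "u \<notin> A" "v \<in> A" | "u \<notin> A" "v \<notin> A"
      by blast
    then show "card (e \<inter> A) \<le> of_bool (e \<in> cross A ?C) + 2 * of_bool (e \<in> pairs_on A)"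
    proof cases
      case 1
      then have "e \<in> pairs_on A" "e \<inter> A = e" "card e = 2"
        using uv by (auto simp: pairs_on_def)
      then show ?thesis by simp
    next
      case 2
      then have "e \<in> cross A ?C" "e \<inter> A = {u}"
        using cr[of u v] uv e by auto
      then show ?thesis by simp
    next
      case 3
      then have "e \<in> cross A ?C" "e \<inter> A = {v}"
        using cr[of v u] uv e by (auto simp: insert_commute)
      then show ?thesis by simp
    next
      case 4
      then have "e \<inter> A = {}" using uv by auto
      then show ?thesis by simp
    qed
  qed
  also have "\<dots> = card (E \<inter> cross A ?C) + 2 * card (E \<inter> pairs_on A)"
    using finE by (simp add: sum.distrib sum_distrib_left[symmetric] Int_def)
  finally have "real (d * card A) \<le> real (card (E \<inter> cross A ?C) + 2 * card (E \<inter> pairs_on A))"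
    by (simp only: of_nat_le_iff)
  then have "real d * a \<le> card (E \<inter> cross A ?C) + 2 * real (card (E \<inter> pairs_on A))"
    by (simp add: a_def)
  also have "\<dots> < (1 + \<delta>) * d * (a * (real n - 2 * a)) / n + 2 * ((1 + \<delta>) * d * (a\<^sup>2 / 2) / n)"
    using less by linarith
  \<comment> \<open>The pair counts combine to \<open>a * (n - 2 * a) + a^2 = a * (n - a)\<close>.
    The factor \<open>1 - a / n \<le> 1 - \<delta>\<close> then outweighs
    \<open>1 + \<delta>\<close>.\<close>
  also have "\<dots> = real d * a * ((1 + \<delta>) * (1 - a / n))"
    using n by (simp add: field_simps power2_eq_square)
  also have "\<dots> \<le> real d * a * 1"
  proof (rule mult_left_mono)
    have "\<delta> \<le> a / n" using \<delta> n by (simp add: a_def field_simps)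
    then have "(1 + \<delta>) * (1 - a / n) \<le> (1 + \<delta>) * (1 - \<delta>)"
      using \<delta> by (intro mult_left_mono) auto
    also have "\<dots> \<le> 1" by (simp add: algebra_simps)
    finally show "(1 + \<delta>) * (1 - a / n) \<le> 1" .
  qed (use a in auto)
  finally show False by simp
qed

text \<open>There are at most \<open>4^n\<close> pairs \<open>(A, B)\<close>, each with two tail
  events of probability at most \<open>8^(-n)\<close>. This is why \<open>L\<close> must satisfy
  \<open>8 \<le> (1 + \<delta> / 2)^L\<close>, and \<open>d\<close> must be large in terms of
  \<open>L\<close>.\<close>

lemma not_mixes_bound:
  fixes \<delta> :: real
  assumes \<delta>: "0 < \<delta>" "\<delta> \<le> 1 / 8" and L: "32 * real L \<le> \<delta> ^ 3 * d" "8 \<le> (1 + \<delta> / 2) ^ L" and d: "0 < d"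
    and n: "32 * (real d + 1) \<le> \<delta> * n"
  shows "card {E \<in> regular_graphs n d. \<not> mixes \<delta> n E} \<le> 2 / 2 ^ n * card (regular_graphs n d)"
proof -
  let ?R = "regular_graphs n d"
  define a where "a = nat \<lceil>\<delta> * n\<rceil>"
  define p where "p = (1 / (1 + \<delta> / 2)) ^ (L * n)"
  define b1 where "b1 = (\<lambda>A B. {E \<in> ?R. (1 + \<delta>) * d * (real a * (real n - 2 * real a)) / n
      \<le> card (E \<inter> cross A ({..<n} - A - B))})"
  define b2 where "b2 = (\<lambda>A. {E \<in> ?R. (1 + \<delta>) * d * ((real a)\<^sup>2 / 2) / n \<le> card (E \<inter> pairs_on A)})"
  define I where "I = {(A, B). A \<subseteq> {..<n} \<and> B \<subseteq> {..<n} \<and> A \<inter> B = {} \<and> card A = a \<and> card B = a}"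
  have "\<delta> * n \<le> 1 / 8 * n"
    using \<delta> by (intro mult_right_mono) auto
  then have n8: "256 \<le> real n" using n d by simp
  have a: "\<delta> * n \<le> a" "a \<le> \<delta> * n + 1"
    unfolding a_def using \<delta> by (auto simp: of_nat_nat intro: less_imp_le)
  \<comment> \<open>Gives \<open>n - 2 * a \<ge> a\<close>, so the cross pairs are numerous enough
    for the concentration bound; the \<open>+ 1\<close> from rounding is absorbed by
    \<open>n \<ge> 256\<close>.\<close>
  have a4: "4 * real a \<le> n"
    using a(2) \<open>\<delta> * n \<le> 1 / 8 * n\<close> n8 by linarith
  have finb: "finite (b1 A B)" "finite (b2 A)" for A B
    using finite_regular_graphs by (auto simp: b1_def b2_def)
  have I: "I \<subseteq> Pow {..<n} \<times> Pow {..<n}"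
    by (auto simp: I_def)
  have finI: "finite I"
    using I finite_subset by fastforce
  have "card I \<le> card (Pow {..<n} \<times> Pow {..<n})"
    using I by (intro card_mono) auto
  also have "\<dots> = 4 ^ n"
    by (simp add: card_cartesian_product card_Pow power_mult_distrib[symmetric])
  finally have cardI: "real (card I) \<le> 4 ^ n"
    by (metis of_nat_le_iff of_nat_numeral of_nat_power)
  have "{E \<in> ?R. \<not> mixes \<delta> n E} \<subseteq> (\<Union>(A, B)\<in>I. b1 A B \<union> b2 A)"
  proof
    fix E assume E: "E \<in> {E \<in> ?R. \<not> mixes \<delta> n E}"
    then obtain A B where AB: "A \<subseteq> {..<n}" "B \<subseteq> {..<n}" "A \<inter> B = {}" "card A = a" "card B = a"
        "\<And>u v. u \<in> A \<Longrightarrow> v \<in> B \<Longrightarrow> {u, v} \<notin> E"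
      unfolding a_def by (auto elim: not_mixes_witness)
    then have "E \<in> b1 A B \<or> E \<in> b2 A"
      using separated_sets_excess[of E n d A B \<delta>] E d \<delta> a n8 unfolding b1_def b2_def by auto
    then show "E \<in> (\<Union>(A, B)\<in>I. b1 A B \<union> b2 A)"
      using AB by (auto simp: I_def)
  qed
  then have "card {E \<in> ?R. \<not> mixes \<delta> n E} \<le> card (\<Union>(A, B)\<in>I. b1 A B \<union> b2 A)"
    using finI finb by (intro card_mono) auto
  also have "\<dots> \<le> (\<Sum>(A, B)\<in>I. card (b1 A B \<union> b2 A))"
    using card_UN_le[OF finI, of "\<lambda>(A, B). b1 A B \<union> b2 A"] by (simp add: case_prod_unfold)
  also have "\<dots> \<le> (\<Sum>(A, B)\<in>I. card (b1 A B) + card (b2 A))"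
    by (intro sum_mono) (auto intro: card_Un_le)
  finally have "real (card {E \<in> ?R. \<not> mixes \<delta> n E}) \<le> (\<Sum>(A, B)\<in>I. real (card (b1 A B)) + real (card (b2 A)))"
    by (simp only: case_prod_unfold of_nat_add[symmetric] of_nat_sum[symmetric] of_nat_le_iff)
  also have "\<dots> \<le> (\<Sum>(A, B)\<in>I. p * card ?R + p * card ?R)"
  proof (rule sum_mono, clarify, rule add_mono)
    fix A B assume "(A, B) \<in> I"
    then have AB: "A \<subseteq> {..<n}" "B \<subseteq> {..<n}" "A \<inter> B = {}" "card A = a" "card B = a"
      by (auto simp: I_def)
    have fin: "finite A" "finite B"
      using AB(1,2) finite_lessThan finite_subset by blast+
    have "card ({..<n} - A - B) = card ({..<n} - (A \<union> B))"
      by (simp add: Diff_eq Int_assoc)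
    also have "\<dots> = n - 2 * a"
      using AB fin by (subst card_Diff_subset) (auto simp: card_Un_disjoint)
    finally have cardC: "real (card ({..<n} - A - B)) = real n - 2 * real a"
      using a4 by simp
    have na: "\<delta>\<^sup>2 * (real n)\<^sup>2 \<le> (real a)\<^sup>2"
      using a(1) \<delta> by (simp only: power_mult_distrib[symmetric]) (intro power_mono, auto)
    show "real (card (b1 A B)) \<le> p * card ?R"
      unfolding b1_def p_def
    proof (rule edge_count_concentration)
      show "cross A ({..<n} - A - B) \<subseteq> pairs n"
        using AB by (intro cross_subset) auto
      have "real (card (cross A ({..<n} - A - B))) \<le> real (card A * card ({..<n} - A - B))"
        using fin by (intro of_nat_mono card_cross_le) auto
      then show "real (card (cross A ({..<n} - A - B))) \<le> real a * (real n - 2 * real a)"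
        using AB cardC by simp
      have "(real a)\<^sup>2 \<le> real a * (real n - 2 * real a)"
        using a4 by (auto simp: power2_eq_square intro!: mult_left_mono)
      moreover have "0 \<le> \<delta>\<^sup>2 * (real n)\<^sup>2" by simp
      ultimately show "\<delta>\<^sup>2 * (real n)\<^sup>2 / 2 \<le> real a * (real n - 2 * real a)"
        using na by linarith
      have "real a * (real n - 2 * real a) \<le> (real n / 4) * real n"
        using a4 by (intro mult_mono) auto
      also have "\<dots> \<le> (real n)\<^sup>2 / 2"
        by (simp add: power2_eq_square)
      finally show "real a * (real n - 2 * real a) \<le> (real n)\<^sup>2 / 2" .
    qed (use \<delta> L d n in auto)
    show "real (card (b2 A)) \<le> p * card ?R"
      unfolding b2_def p_def
    proof (rule edge_count_concentration)
      show "pairs_on A \<subseteq> pairs n"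
        using AB by (intro pairs_on_subset)
      show "real (card (pairs_on A)) \<le> (real a)\<^sup>2 / 2"
        using card_pairs_on_le[OF fin(1)] AB by simp
      show "\<delta>\<^sup>2 * (real n)\<^sup>2 / 2 \<le> (real a)\<^sup>2 / 2"
        using na by simp
      show "(real a)\<^sup>2 / 2 \<le> (real n)\<^sup>2 / 2"
        using a4 by (intro divide_right_mono power_mono) auto
    qed (use \<delta> L d n in auto)
  qed
  also have "\<dots> = real (card I) * (2 * p * card ?R)"
    by simp
  also have "\<dots> \<le> 4 ^ n * (2 * (1 / 8 ^ n) * card ?R)"
  proof (intro mult_mono mult_left_mono cardI)
    have "p = 1 / ((1 + \<delta> / 2) ^ L) ^ n"
      by (simp add: p_def power_divide power_mult)
    also have "\<dots> \<le> 1 / 8 ^ n"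
      using L \<delta> by (intro divide_left_mono power_mono) auto
    finally show "p \<le> 1 / 8 ^ n" .
  qed (use \<delta> in \<open>auto simp: p_def\<close>)
  also have "\<dots> = 2 / 2 ^ n * card ?R"
  proof -
    have "(8::real) ^ n = 4 ^ n * 2 ^ n"
      by (simp flip: power_mult_distrib)
    then show ?thesis by simp
  qed
  finally show ?thesis .
qed

section \<open>Choice of constants and combination of the two failure bounds\<close>

theorem theorem5p2:
  shows "\<forall>\<epsilon>::real. \<epsilon> > 0 \<longrightarrow> (\<exists>d0::nat. \<forall>d\<ge>d0.
           whp d (\<lambda>n E. spread n E < ereal (1/4 + \<epsilon>)))"
proof (intro allI impI)
  fix \<epsilon> :: real assume "\<epsilon> > 0"
  \<comment> \<open>\<open>\<epsilon> / 32\<close> leaves \<open>16 * \<delta>\<close> strictly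
    below \<open>\<epsilon>\<close>; \<open>1 / 3072\<close> is the cap from the expansion
    bound.\<close>
  define \<delta> where "\<delta> = min (\<epsilon> / 32) (1 / 3072)"
  have \<delta>: "0 < \<delta>" "\<delta> \<le> 1 / 3072" "16 * \<delta> < \<epsilon>"
    using \<open>\<epsilon> > 0\<close> by (auto simp: \<delta>_def min_def)
  \<comment> \<open>\<open>L\<close> depends on \<open>\<delta>\<close> alone, so it can be fixed
    before \<open>d\<close>.\<close>
  obtain L :: nat where L: "8 < (1 + \<delta> / 2) ^ L"
    using real_arch_pow[of "1 + \<delta> / 2" 8] \<delta> by auto
  obtain d1 :: nat where d1: "32 * real L / \<delta> ^ 3 \<le> d1"
    using real_arch_simple by blast
  show "\<exists>d0::nat. \<forall>d\<ge>d0. whp d (\<lambda>n E. spread n E < ereal (1/4 + \<epsilon>))"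
  proof (intro exI[of _ "max 24 d1"] allI impI)
    fix d assume "max 24 d1 \<le> d"
    then have d: "24 \<le> d" "32 * real L / \<delta> ^ 3 \<le> d"
      using d1 by auto
    then have Ld: "32 * real L \<le> \<delta> ^ 3 * d"
      using \<delta> by (simp add: field_simps)
    show "whp d (\<lambda>n E. spread n E < ereal (1/4 + \<epsilon>))"
      unfolding whp_def
    proof (intro allI impI)
      fix \<gamma> :: real assume "\<gamma> > 0"
      \<comment> \<open>The first summand meets the size conditions on \<open>n\<close>; the second
        makes the total failure probability \<open>34 / n\<close> at most
        \<open>\<gamma>\<close>.\<close>
      obtain N :: nat where N: "32 * (real d + 1) / \<delta> + 34 / \<gamma> \<le> N"
        using real_arch_simple by blast
      show "\<exists>N. \<forall>n\<ge>N. even (n * d) \<longrightarrow> 1 - \<gamma> \<le> prob_Gnd n d (\<lambda>E. spread n E < ereal (1/4 + \<epsilon>))"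
      proof (intro exI[of _ N] allI impI)
        fix n assume "N \<le> n" and even: "even (n * d)"
        then have n: "32 * (real d + 1) / \<delta> + 34 / \<gamma> \<le> n"
          using N by linarith
        have "0 \<le> 34 / \<gamma>" "0 \<le> 32 * (real d + 1) / \<delta>"
          using \<open>\<gamma> > 0\<close> \<delta> by auto
        then have n1: "32 * (real d + 1) / \<delta> \<le> n" and n2: "34 / \<gamma> \<le> n"
          using n by linarith+
        have n3: "32 * (real d + 1) \<le> \<delta> * n"
          using n1 \<delta> by (simp add: field_simps)
        also have "\<dots> \<le> 1 * real n"
          using \<delta> by (intro mult_right_mono) auto
        finally have "real (32 * (d + 1)) \<le> real n" by simp
        then have "32 * (d + 1) \<le> n" by (simp only: of_nat_le_iff)
        then have n4: "8 * (d + 1) \<le> n" "2 * d + 2 \<le> n" "0 < n" by auto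
        let ?R = "regular_graphs n d"
        let ?good = "{E \<in> ?R. spread n E < ereal (1/4 + \<epsilon>)}"
        have R: "0 < card ?R"
          using regular_graphs_nonempty[OF n4(2) even] finite_regular_graphs by (simp add: card_gt_0_iff)
        have good: "spread n E < ereal (1/4 + \<epsilon>)" if "E \<in> ?R" "expands \<delta> n E" "mixes \<delta> n E" for E
        proof -
          \<comment> \<open>The bound is uniform in \<open>f\<close>, and the gap between
            \<open>16 * \<delta>\<close> and \<open>\<epsilon>\<close> keeps the inequality strict
            after the supremum.\<close>
          have "spread n E \<le> ereal (1/4 + 16 * \<delta>)"
            unfolding spread_def using lipschitz_variance_le[OF that] n4 \<delta> by (intro SUP_least) auto
          also have "\<dots> < ereal (1/4 + \<epsilon>)" using \<delta> by simp
          finally show ?thesis .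
        qed
        have "?R \<subseteq> ?good \<union> ({E \<in> ?R. \<not> expands \<delta> n E} \<union> {E \<in> ?R. \<not> mixes \<delta> n E})"
          using good by auto
        then have "card ?R \<le> card (?good \<union> ({E \<in> ?R. \<not> expands \<delta> n E} \<union> {E \<in> ?R. \<not> mixes \<delta> n E}))"
          using finite_regular_graphs by (intro card_mono) auto
        also have "\<dots> \<le> card ?good + (card {E \<in> ?R. \<not> expands \<delta> n E} + card {E \<in> ?R. \<not> mixes \<delta> n E})"
          by (meson add_left_mono card_Un_le order_trans)
        finally have "real (card ?R) \<le> card ?good
            + (real (card {E \<in> ?R. \<not> expands \<delta> n E}) + real (card {E \<in> ?R. \<not> mixes \<delta> n E}))"
          by linarith
        also have "\<dots> \<le> card ?good + (32 / n * card ?R + 2 / 2 ^ n * card ?R)"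
          using \<delta> d n3 n4 L Ld
          by (intro add_left_mono add_mono not_expands_bound not_mixes_bound) auto
        also have "\<dots> \<le> card ?good + (32 / n * card ?R + 2 / n * card ?R)"
        proof -
          have "real n \<le> 2 ^ n"
            using less_exp[of n] by (metis less_imp_le of_nat_le_iff of_nat_numeral of_nat_power)
          then have "2 / 2 ^ n \<le> 2 / real n"
            using n4 by (intro divide_left_mono) auto
          then show ?thesis by (intro add_left_mono mult_right_mono) auto
        qed
        also have "\<dots> = card ?good + 34 / n * card ?R"
          by (simp add: field_simps)
        also have "\<dots> \<le> card ?good + \<gamma> * card ?R"
          using n2 n4 \<open>\<gamma> > 0\<close> by (intro add_left_mono mult_right_mono) (auto simp: field_simps)
        finally have "(1 - \<gamma>) * card ?R \<le> card ?good"
          by (simp add: algebra_simps)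
        then show "1 - \<gamma> \<le> prob_Gnd n d (\<lambda>E. spread n E < ereal (1/4 + \<epsilon>))"
          using R by (simp add: prob_Gnd_def field_simps)
      qed
    qed
  qed
qed

end
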